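(* Let $\Psi:\mathcal A_1\to\mathcal A_2$ be an isomorphism of algebraic noncommutative geometries, and let $\mathcal A_1$ be a quantum group with coproduct $\Delta_1$, counit $\epsilon_1$ and antipode $S_1$. Then $\mathcal A_2$ is also a quantum group, with $$\Delta_2=(\Psi\otimes\Psi)\circ\Delta_1\circ\Psi^{-1},\qquad \epsilon_2=\epsilon_1\circ\Psi^{-1},\qquad S_2=\Psi\circ S_1\circ\Psi^{-1}.$$
   Context: Algebraic noncommutative geometry (ANCG). Let $\mathcal F^0$ be the free associative noncommutative unital complex algebra on generators $x_1,\dots,x_n$. Let $\mathcal F$ be either the algebra of polynomials, or the algebra of formal power series, in a central variable $\varepsilon$ with coefficients in $\mathcal F^0$. An ANCG is a quotient algebra $q:\mathcal F\to\mathcal A$ by the two-sided ideal generated by elements $c_{ij}$ ($i,j=1,\dots,n$) and $b_s$ ($s=1,\dots,n-D$) of $\mathcal F$, for some $D\le n$, such that: (1) $\mathcal A$ is associative and noncommutative; (2) $c_{ij}=x_ix_j-x_jx_i-i\varepsilon c'_{ij}$ with $c'_{ij}\in\mathcal F$, and for at least one pair $(i,j)$ the image of $c'_{ij}$ in $\mathcal A/\varepsilon\mathcal A$ is nonzero; (3) the image of each $b_s$ in $\mathbb C[x_1,\dots,x_n]$ under setting $\varepsilon=0$ and letting the generators commute is nonzero; (4) there is a conjugation $\dagger$ on $\mathcal A$, antilinear over $\mathbb C$, with $(uv)^\dagger=v^\dagger u^\dagger$, $u^{\dagger\dagger}=u$, $\varepsilon^\dagger=\varepsilon$, $x_i^\dagger=x_i$.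 An isomorphism of ANCG is a bijective algebra homomorphism $\Psi:\mathcal A_1\to\mathcal A_2$ with $\Psi(\varepsilon_1)=\varepsilon_2$, where $\varepsilon_k$ is the central parameter of $\mathcal A_k$. "Quantum group" means Hopf algebra over $\mathbb C$ (on the given algebra structure). *)

theory Defs
  imports Complex_Main "HOL-Algebra.Algebra" "HOL-Library.Poly_Mapping"
    "HOL-Computational_Algebra.Formal_Power_Series"
begin

section \<open>Associative unital complex algebras\<close>

definition complex_alg :: "(complex, complex) module" where
  "complex_alg = \<lparr>carrier = UNIV, monoid.mult = (*), one = 1,
     ring.zero = 0, ring.add = (+), smult = (*)\<rparr>"

text \<open>The library's \<^locale>\<open>algebra\<close> requires a commutative multiplication.\<close>

locale complex_algebra = module complex_alg A + ring A
  for A :: "(complex, 'a) module" (structure) +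
  assumes smult_mult_left:
      "\<lbrakk>u \<in> carrier A; v \<in> carrier A\<rbrakk> \<Longrightarrow> (c \<odot> u) \<otimes> v = c \<odot> (u \<otimes> v)"
    and smult_mult_right:
      "\<lbrakk>u \<in> carrier A; v \<in> carrier A\<rbrakk> \<Longrightarrow> u \<otimes> (c \<odot> v) = c \<odot> (u \<otimes> v)"

definition linear_maps ::
    "(complex, 'a) module \<Rightarrow> (complex, 'b) module \<Rightarrow> ('a \<Rightarrow> 'b) set" where
  "linear_maps M N = {f. f \<in> carrier M \<rightarrow> carrier N \<and>
     (\<forall>u\<in>carrier M. \<forall>v\<in>carrier M. f (u \<oplus>\<^bsub>M\<^esub> v) = f u \<oplus>\<^bsub>N\<^esub> f v) \<and>
     (\<forall>c. \<forall>u\<in>carrier M. f (c \<odot>\<^bsub>M\<^esub> u) = c \<odot>\<^bsub>N\<^esub> f u)}"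

definition algebra_homs ::
    "(complex, 'a) module \<Rightarrow> (complex, 'b) module \<Rightarrow> ('a \<Rightarrow> 'b) set" where
  "algebra_homs A B = ring_hom A B \<inter> linear_maps A B"


section \<open>Algebraic tensor products over the complex numbers\<close>

text \<open>
  The free vector space on \<open>carrier M \<times> carrier N\<close> consists of the finitely supported functions
  with support in that set; \<open>tensor_null M N\<close> is its subspace generated by the bilinearity
  relations, and \<open>tensor M N\<close> is the quotient.
\<close>

definition pm_scale :: "complex \<Rightarrow> ('k \<Rightarrow>\<^sub>0 complex) \<Rightarrow> ('k \<Rightarrow>\<^sub>0 complex)" where
  "pm_scale c f = Poly_Mapping.map ((*) c) f"

inductive_set tensor_null ::
    "(complex, 'a) module \<Rightarrow> (complex, 'b) module \<Rightarrow> (('a \<times> 'b) \<Rightarrow>\<^sub>0 complex) set"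
  for M N where
  zero: "0 \<in> tensor_null M N"
| add: "\<lbrakk>f \<in> tensor_null M N; g \<in> tensor_null M N\<rbrakk> \<Longrightarrow> f + g \<in> tensor_null M N"
| scale: "f \<in> tensor_null M N \<Longrightarrow> pm_scale c f \<in> tensor_null M N"
| add_left: "\<lbrakk>u \<in> carrier M; u' \<in> carrier M; v \<in> carrier N\<rbrakk> \<Longrightarrow>
    Poly_Mapping.single (u \<oplus>\<^bsub>M\<^esub> u', v) 1 - Poly_Mapping.single (u, v) 1
      - Poly_Mapping.single (u', v) 1 \<in> tensor_null M N"
| add_right: "\<lbrakk>u \<in> carrier M; v \<in> carrier N; v' \<in> carrier N\<rbrakk> \<Longrightarrow>
    Poly_Mapping.single (u, v \<oplus>\<^bsub>N\<^esub> v') 1 - Poly_Mapping.single (u, v) 1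
      - Poly_Mapping.single (u, v') 1 \<in> tensor_null M N"
| smult_left: "\<lbrakk>u \<in> carrier M; v \<in> carrier N\<rbrakk> \<Longrightarrow>
    Poly_Mapping.single (c \<odot>\<^bsub>M\<^esub> u, v) 1 - Poly_Mapping.single (u, v) c \<in> tensor_null M N"
| smult_right: "\<lbrakk>u \<in> carrier M; v \<in> carrier N\<rbrakk> \<Longrightarrow>
    Poly_Mapping.single (u, c \<odot>\<^bsub>N\<^esub> v) 1 - Poly_Mapping.single (u, v) c \<in> tensor_null M N"

definition tensor_class ::
    "(complex, 'a) module \<Rightarrow> (complex, 'b) module \<Rightarrow> (('a \<times> 'b) \<Rightarrow>\<^sub>0 complex)
      \<Rightarrow> (('a \<times> 'b) \<Rightarrow>\<^sub>0 complex) set" where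
  "tensor_class M N f = {g. g - f \<in> tensor_null M N}"

definition tensor_rep :: "(('a \<times> 'b) \<Rightarrow>\<^sub>0 complex) set \<Rightarrow> (('a \<times> 'b) \<Rightarrow>\<^sub>0 complex)" where
  "tensor_rep T = (SOME f. f \<in> T)"

text \<open>
  The operations are computed on representatives, the product being the bilinear extension of
  \<open>(a \<otimes> b)(a' \<otimes> b') = aa' \<otimes> bb'\<close>. The fields \<open>mult\<close> and \<open>one\<close> are meaningful when both
  factors are algebras.
\<close>

definition tensor ::
    "(complex, 'a) module \<Rightarrow> (complex, 'b) module
      \<Rightarrow> (complex, (('a \<times> 'b) \<Rightarrow>\<^sub>0 complex) set) module" where
  "tensor M N =
    \<lparr>carrier = tensor_class M N ` {f. Poly_Mapping.keys f \<subseteq> carrier M \<times> carrier N},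
     monoid.mult = (\<lambda>T U. tensor_class M N
       (\<Sum>p\<in>Poly_Mapping.keys (tensor_rep T). \<Sum>r\<in>Poly_Mapping.keys (tensor_rep U).
          Poly_Mapping.single (fst p \<otimes>\<^bsub>M\<^esub> fst r, snd p \<otimes>\<^bsub>N\<^esub> snd r)
            (Poly_Mapping.lookup (tensor_rep T) p * Poly_Mapping.lookup (tensor_rep U) r))),
     one = tensor_class M N (Poly_Mapping.single (\<one>\<^bsub>M\<^esub>, \<one>\<^bsub>N\<^esub>) 1),
     ring.zero = tensor_class M N 0,
     ring.add = (\<lambda>T U. tensor_class M N (tensor_rep T + tensor_rep U)),
     smult = (\<lambda>c T. tensor_class M N (pm_scale c (tensor_rep T)))\<rparr>"

definition pure_tensor ::
    "(complex, 'a) module \<Rightarrow> (complex, 'b) module \<Rightarrow> 'a \<Rightarrow> 'b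
      \<Rightarrow> (('a \<times> 'b) \<Rightarrow>\<^sub>0 complex) set" where
  "pure_tensor M N u v = tensor_class M N (Poly_Mapping.single (u, v) 1)"

text \<open>
  The linear map out of a tensor product that is induced by a bilinear map \<open>\<beta>\<close> with values in \<open>P\<close>,
  that is, the one sending \<open>u \<otimes> v\<close> to \<open>\<beta> u v\<close>.
\<close>

definition tensor_lift ::
    "(complex, 'p) module \<Rightarrow> ('a \<Rightarrow> 'b \<Rightarrow> 'p) \<Rightarrow> (('a \<times> 'b) \<Rightarrow>\<^sub>0 complex) set \<Rightarrow> 'p" where
  "tensor_lift P \<beta> T = (\<Oplus>\<^bsub>P\<^esub>p\<in>Poly_Mapping.keys (tensor_rep T).
     Poly_Mapping.lookup (tensor_rep T) p \<odot>\<^bsub>P\<^esub> \<beta> (fst p) (snd p))"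

text \<open>The map \<open>f \<otimes> g\<close> with values in \<open>tensor M N\<close>.\<close>

definition tensor_map ::
    "(complex, 'c) module \<Rightarrow> (complex, 'd) module \<Rightarrow> ('a \<Rightarrow> 'c) \<Rightarrow> ('b \<Rightarrow> 'd)
      \<Rightarrow> (('a \<times> 'b) \<Rightarrow>\<^sub>0 complex) set \<Rightarrow> (('c \<times> 'd) \<Rightarrow>\<^sub>0 complex) set" where
  "tensor_map M N f g = tensor_lift (tensor M N) (\<lambda>u v. pure_tensor M N (f u) (g v))"

text \<open>The associativity isomorphism from \<open>(L \<otimes> M) \<otimes> N\<close> to \<open>L \<otimes> (M \<otimes> N)\<close>.\<close>

definition tensor_assoc ::
    "(complex, 'a) module \<Rightarrow> (complex, 'b) module \<Rightarrow> (complex, 'c) module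
      \<Rightarrow> (((('a \<times> 'b) \<Rightarrow>\<^sub>0 complex) set \<times> 'c) \<Rightarrow>\<^sub>0 complex) set
      \<Rightarrow> (('a \<times> (('b \<times> 'c) \<Rightarrow>\<^sub>0 complex) set) \<Rightarrow>\<^sub>0 complex) set" where
  "tensor_assoc L M N =
     tensor_lift (tensor L (tensor M N))
       (\<lambda>t w. tensor_lift (tensor L (tensor M N))
          (\<lambda>u v. pure_tensor L (tensor M N) u (pure_tensor M N v w)) t)"


section \<open>Hopf algebras\<close>

text \<open>
  In the counit axioms \<open>\<complex> \<otimes> H\<close> and \<open>H \<otimes> \<complex>\<close> are identified with \<open>H\<close> by scalar multiplication.
\<close>

locale hopf_algebra = complex_algebra H for H :: "(complex, 'a) module" (structure) +
  fixes \<Delta> :: "'a \<Rightarrow> (('a \<times> 'a) \<Rightarrow>\<^sub>0 complex) set"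
    and counit :: "'a \<Rightarrow> complex"
    and antipode :: "'a \<Rightarrow> 'a"
  assumes coproduct_hom: "\<Delta> \<in> algebra_homs H (tensor H H)"
    and counit_hom: "counit \<in> algebra_homs H complex_alg"
    and coassociative: "h \<in> carrier H \<Longrightarrow>
      tensor_assoc H H H (tensor_map (tensor H H) H \<Delta> (\<lambda>u. u) (\<Delta> h))
        = tensor_map H (tensor H H) (\<lambda>u. u) \<Delta> (\<Delta> h)"
    and counit_left: "h \<in> carrier H \<Longrightarrow>
      tensor_lift H (\<lambda>c u. c \<odot> u) (tensor_map complex_alg H counit (\<lambda>u. u) (\<Delta> h)) = h"
    and counit_right: "h \<in> carrier H \<Longrightarrow>
      tensor_lift H (\<lambda>u c. c \<odot> u) (tensor_map H complex_alg (\<lambda>u. u) counit (\<Delta> h)) = h"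
    and antipode_linear: "antipode \<in> linear_maps H H"
    and antipode_left: "h \<in> carrier H \<Longrightarrow>
      tensor_lift H (\<lambda>u v. u \<otimes> v) (tensor_map H H antipode (\<lambda>u. u) (\<Delta> h)) = counit h \<odot> \<one>"
    and antipode_right: "h \<in> carrier H \<Longrightarrow>
      tensor_lift H (\<lambda>u v. u \<otimes> v) (tensor_map H H (\<lambda>u. u) antipode (\<Delta> h)) = counit h \<odot> \<one>"


section \<open>The free algebra and its extension by a central parameter\<close>

text \<open>
  Words form the free monoid, written additively because \<^type>\<open>poly_mapping\<close> convolves over an
  additive monoid of keys.
\<close>

datatype nc_word = NCWord (letters: "nat list")

instantiation nc_word :: monoid_add
begin

definition zero_nc_word :: nc_word where
  "zero_nc_word = NCWord []"

definition plus_nc_word :: "nc_word \<Rightarrow> nc_word \<Rightarrow> nc_word" where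
  "plus_nc_word v w = NCWord (letters v @ letters w)"

instance
  by standard (simp_all add: zero_nc_word_def plus_nc_word_def)

end

type_synonym free_alg = "nc_word \<Rightarrow>\<^sub>0 complex"

definition free_carrier :: "nat \<Rightarrow> free_alg set" where
  "free_carrier n = {f. \<forall>w\<in>Poly_Mapping.keys f. set (letters w) \<subseteq> {1..n}}"

definition gen :: "nat \<Rightarrow> free_alg fps" where
  "gen i = fps_const (Poly_Mapping.single (NCWord [i]) 1)"

definition scalar :: "complex \<Rightarrow> free_alg fps" where
  "scalar c = fps_const (Poly_Mapping.single 0 c)"

abbreviation epsilon :: "free_alg fps" where
  "epsilon \<equiv> fps_X"

text \<open>
  Polynomials in the central variable are the power series with finitely many nonzero
  coefficients.
\<close>

datatype parameter_kind = Polynomials | Power_Series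

definition param_alg :: "parameter_kind \<Rightarrow> nat \<Rightarrow> (complex, free_alg fps) module" where
  "param_alg k n =
    \<lparr>carrier = {f. (\<forall>m. fps_nth f m \<in> free_carrier n) \<and>
                    (k = Polynomials \<longrightarrow> finite {m. fps_nth f m \<noteq> 0})},
     monoid.mult = (*), one = 1, ring.zero = 0, ring.add = (+), smult = (\<lambda>c f. scalar c * f)\<rparr>"

text \<open>Letting the generators commute, with values in the commutative polynomials.\<close>

definition abelianize :: "free_alg \<Rightarrow> ((nat \<Rightarrow>\<^sub>0 nat) \<Rightarrow>\<^sub>0 complex)" where
  "abelianize f = (\<Sum>w\<in>Poly_Mapping.keys f.
     Poly_Mapping.single (\<Sum>i\<leftarrow>letters w. Poly_Mapping.single i 1) (Poly_Mapping.lookup f w))"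


section \<open>Algebraic noncommutative geometries\<close>

definition commutator_relation ::
    "(nat \<Rightarrow> nat \<Rightarrow> free_alg fps) \<Rightarrow> nat \<Rightarrow> nat \<Rightarrow> free_alg fps" where
  "commutator_relation c' i j =
     gen i * gen j - gen j * gen i - scalar \<i> * epsilon * c' i j"

definition multiples :: "(complex, 'a) module \<Rightarrow> 'a \<Rightarrow> 'a set" where
  "multiples A e = {e \<otimes>\<^bsub>A\<^esub> u | u. u \<in> carrier A}"

text \<open>
  Being a quotient algebra is expressed by a surjective algebra homomorphism \<open>q\<close> whose kernel is
  the two-sided ideal generated by the relations. For the central element \<open>e = q epsilon\<close> the set
  \<open>multiples A e\<close> is the two-sided ideal \<open>\<epsilon>A\<close>.
\<close>

locale ancg = complex_algebra A for A :: "(complex, 'a) module" (structure) +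
  fixes k :: parameter_kind
    and n D :: nat
    and c' :: "nat \<Rightarrow> nat \<Rightarrow> free_alg fps"
    and b :: "nat \<Rightarrow> free_alg fps"
    and q :: "free_alg fps \<Rightarrow> 'a"
  assumes D_le_n: "D \<le> n"
    and c'_closed: "\<lbrakk>i \<in> {1..n}; j \<in> {1..n}\<rbrakk> \<Longrightarrow> c' i j \<in> carrier (param_alg k n)"
    and b_closed: "s \<in> {1..n - D} \<Longrightarrow> b s \<in> carrier (param_alg k n)"
    and q_hom: "q \<in> algebra_homs (param_alg k n) A"
    and q_surj: "q ` carrier (param_alg k n) = carrier A"
    and q_kernel: "a_kernel (param_alg k n) A q =
      Idl\<^bsub>param_alg k n\<^esub>
        ({commutator_relation c' i j | i j. i \<in> {1..n} \<and> j \<in> {1..n}} \<union> b ` {1..n - D})"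
    and noncommutative: "\<exists>u\<in>carrier A. \<exists>v\<in>carrier A. u \<otimes> v \<noteq> v \<otimes> u"
    and c'_nonzero: "\<exists>i\<in>{1..n}. \<exists>j\<in>{1..n}.
      multiples A (q epsilon) +> q (c' i j) \<noteq> \<zero>\<^bsub>A Quot multiples A (q epsilon)\<^esub>"
    and b_nonzero: "s \<in> {1..n - D} \<Longrightarrow> abelianize (fps_nth (b s) 0) \<noteq> 0"
    and conjugation: "\<exists>dag. dag \<in> carrier A \<rightarrow> carrier A \<and>
      (\<forall>u\<in>carrier A. \<forall>v\<in>carrier A. dag (u \<oplus> v) = dag u \<oplus> dag v) \<and>
      (\<forall>z. \<forall>u\<in>carrier A. dag (z \<odot> u) = cnj z \<odot> dag u) \<and>
      (\<forall>u\<in>carrier A. \<forall>v\<in>carrier A. dag (u \<otimes> v) = dag v \<otimes> dag u) \<and>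
      (\<forall>u\<in>carrier A. dag (dag u) = u) \<and>
      dag (q epsilon) = q epsilon \<and>
      (\<forall>i\<in>{1..n}. dag (q (gen i)) = q (gen i))"

text \<open>Here \<open>e1\<close> and \<open>e2\<close> are the central parameters of \<open>A1\<close> and \<open>A2\<close>.\<close>

definition ancg_iso ::
    "(complex, 'a) module \<Rightarrow> 'a \<Rightarrow> (complex, 'b) module \<Rightarrow> 'b \<Rightarrow> ('a \<Rightarrow> 'b) \<Rightarrow> bool" where
  "ancg_iso A1 e1 A2 e2 \<Psi> \<longleftrightarrow>
     \<Psi> \<in> algebra_homs A1 A2 \<and> bij_betw \<Psi> (carrier A1) (carrier A2) \<and> \<Psi> e1 = e2"

end

theory Submission
  imports Defs
begin

text \<open>
  The tensor product has the universal property of bilinear maps, so \<open>tensor_lift\<close> and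
  \<open>tensor_map\<close> can be computed on pure tensors. Hence \<open>\<Psi> \<otimes> \<Psi>\<close> is an algebra homomorphism,
  the associativity isomorphism is natural, and \<open>(f' \<otimes> g') \<circ> (f \<otimes> g) = (f' \<circ> f) \<otimes> (g' \<circ> g)\<close>.
  Each Hopf axiom for \<open>A2\<close> at \<open>h\<close> is then the image under \<open>\<Psi>\<close>, or a tensor power of it, of the
  corresponding axiom for \<open>A1\<close> at \<open>\<Psi>\<^sup>-\<^sup>1 h\<close>.
\<close>

subsection \<open>Linear and bilinear maps\<close>

text \<open>Two things resist direct calculation. The operations of \<open>tensor\<close> and the
  values of \<open>tensor_lift\<close> are computed on a representative picked by Hilbert choice, so
  even the linearity of \<open>tensor_lift\<close> rests on the pick being immaterial: any two
  representatives of a class differ by an element of \<open>tensor_null\<close>, and the linear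
  extension of a bilinear map vanishes there. Moreover, maps between carriers are total functions
  with arbitrary values elsewhere: \<open>inv_into\<close> inverts \<Psi> on the carriers only, so
  an identity such as \<open>\<Delta>\<^sub>2 \<circ> \<Psi> = (\<Psi> \<otimes> \<Psi>) \<circ>
  \<Delta>\<^sub>1\<close> holds pointwise on a carrier and enters through congruence rules, not as
  an equality of functions. The product of \<open>tensor\<close> and the associativity map can both
  be written as a lift inside a lift. Handling them requires that a lift depends linearly on a
  parameter of its bilinear map; this is what makes the integrand of the outer lift
  bilinear.\<close>

lemma complex_alg_simps [simp]:
  "carrier complex_alg = UNIV" "monoid.mult complex_alg = (*)" "one complex_alg = 1"
  "ring.zero complex_alg = 0" "ring.add complex_alg = (+)" "smult complex_alg = (*)"
  by (simp_all add: complex_alg_def)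

text \<open>In the counit axioms the field is itself a tensor factor and the target of a linear map,
  so it has to serve as a module over itself.\<close>

lemma module_complex_alg: "module complex_alg complex_alg"
proof (rule moduleI)
  have ab: "abelian_group complex_alg"
    by (rule abelian_groupI) (auto simp: algebra_simps intro: exI[of _ "- x" for x])
  show "abelian_group complex_alg" by (fact ab)
  show "cring complex_alg"
    by (intro cringI ab comm_monoidI) (auto simp: algebra_simps)
qed (auto simp: algebra_simps)

lemma linear_mapsI:
  assumes "\<And>u. u \<in> carrier M \<Longrightarrow> f u \<in> carrier N"
    and "\<And>u v. u \<in> carrier M \<Longrightarrow> v \<in> carrier M \<Longrightarrow> f (u \<oplus>\<^bsub>M\<^esub> v) = f u \<oplus>\<^bsub>N\<^esub> f v"
    and "\<And>c u. u \<in> carrier M \<Longrightarrow> f (c \<odot>\<^bsub>M\<^esub> u) = c \<odot>\<^bsub>N\<^esub> f u"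
  shows "f \<in> linear_maps M N"
  using assms by (auto simp: linear_maps_def)

lemma linear_mapsD:
  assumes "f \<in> linear_maps M N"
  shows linear_maps_closed: "u \<in> carrier M \<Longrightarrow> f u \<in> carrier N"
    and linear_maps_add: "u \<in> carrier M \<Longrightarrow> v \<in> carrier M \<Longrightarrow> f (u \<oplus>\<^bsub>M\<^esub> v) = f u \<oplus>\<^bsub>N\<^esub> f v"
    and linear_maps_smult: "u \<in> carrier M \<Longrightarrow> f (c \<odot>\<^bsub>M\<^esub> u) = c \<odot>\<^bsub>N\<^esub> f u"
  using assms by (auto simp: linear_maps_def)

lemma linear_maps_id: "(\<lambda>u. u) \<in> linear_maps M M"
  by (auto simp: linear_maps_def)

lemma linear_maps_comp:
  assumes "f \<in> linear_maps L M" "g \<in> linear_maps M N"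
  shows "(\<lambda>u. g (f u)) \<in> linear_maps L N"
  using assms by (auto simp: linear_maps_def Pi_iff)

text \<open>Bilinearity is phrased through partial applications, so that fixing one argument
  directly yields a member of \<open>linear_maps\<close>, as nested lifts require. Values outside
  the carriers are left unconstrained.\<close>

definition bilinear_maps ::
    "(complex, 'a) module \<Rightarrow> (complex, 'b) module \<Rightarrow> (complex, 'p) module
      \<Rightarrow> ('a \<Rightarrow> 'b \<Rightarrow> 'p) set" where
  "bilinear_maps M N P = {\<beta>. (\<forall>u\<in>carrier M. \<beta> u \<in> linear_maps N P) \<and>
     (\<forall>v\<in>carrier N. (\<lambda>u. \<beta> u v) \<in> linear_maps M P)}"

lemma bilinear_mapsD:
  assumes "\<beta> \<in> bilinear_maps M N P"
  shows "u \<in> carrier M \<Longrightarrow> \<beta> u \<in> linear_maps N P"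
    and "v \<in> carrier N \<Longrightarrow> (\<lambda>u. \<beta> u v) \<in> linear_maps M P"
    and bilinear_maps_closed: "u \<in> carrier M \<Longrightarrow> v \<in> carrier N \<Longrightarrow> \<beta> u v \<in> carrier P"
    and "u \<in> carrier M \<Longrightarrow> u' \<in> carrier M \<Longrightarrow> v \<in> carrier N
      \<Longrightarrow> \<beta> (u \<oplus>\<^bsub>M\<^esub> u') v = \<beta> u v \<oplus>\<^bsub>P\<^esub> \<beta> u' v"
    and "u \<in> carrier M \<Longrightarrow> v \<in> carrier N \<Longrightarrow> v' \<in> carrier N
      \<Longrightarrow> \<beta> u (v \<oplus>\<^bsub>N\<^esub> v') = \<beta> u v \<oplus>\<^bsub>P\<^esub> \<beta> u v'"
    and "u \<in> carrier M \<Longrightarrow> v \<in> carrier N \<Longrightarrow> \<beta> (c \<odot>\<^bsub>M\<^esub> u) v = c \<odot>\<^bsub>P\<^esub> \<beta> u v"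
    and "u \<in> carrier M \<Longrightarrow> v \<in> carrier N \<Longrightarrow> \<beta> u (c \<odot>\<^bsub>N\<^esub> v) = c \<odot>\<^bsub>P\<^esub> \<beta> u v"
  using assms by (auto simp: bilinear_maps_def linear_maps_def)

lemma bilinear_mapsI:
  assumes "\<And>u. u \<in> carrier M \<Longrightarrow> \<beta> u \<in> linear_maps N P"
    and "\<And>v. v \<in> carrier N \<Longrightarrow> (\<lambda>u. \<beta> u v) \<in> linear_maps M P"
  shows "\<beta> \<in> bilinear_maps M N P"
  using assms by (auto simp: bilinear_maps_def)

lemma bilinear_maps_comp:
  assumes "f \<in> linear_maps M' M" "g \<in> linear_maps N' N" "\<beta> \<in> bilinear_maps M N P"
  shows "(\<lambda>u v. \<beta> (f u) (g v)) \<in> bilinear_maps M' N' P"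
  using assms by (auto simp: bilinear_maps_def linear_maps_def Pi_iff)

lemma linear_bilinear_comp:
  assumes "\<beta> \<in> bilinear_maps M N P" "\<phi> \<in> linear_maps P Q"
  shows "(\<lambda>u v. \<phi> (\<beta> u v)) \<in> bilinear_maps M N Q"
  using assms by (auto simp: bilinear_maps_def linear_maps_def Pi_iff)

section \<open>Scaling of, and induction on, finitely supported functions\<close>

lemma lookup_pm_scale [simp]: "Poly_Mapping.lookup (pm_scale c f) p = c * Poly_Mapping.lookup f p"
  by (simp add: pm_scale_def Poly_Mapping.map.rep_eq when_def)

lemma keys_pm_scale: "Poly_Mapping.keys (pm_scale c f) \<subseteq> Poly_Mapping.keys f"
  by (auto simp: in_keys_iff)

lemma pm_scale_add: "pm_scale c (f + g) = pm_scale c f + pm_scale c g"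
  by (rule poly_mapping_eqI) (simp add: lookup_add algebra_simps)

lemma pm_scale_diff: "pm_scale c (f - g) = pm_scale c f - pm_scale c g"
  by (rule poly_mapping_eqI) (simp add: lookup_minus algebra_simps)

text \<open>Subspaces such as \<open>tensor_null\<close> are given by closure under sums and
  scaling; this form brings differences under those two rules.\<close>

lemma diff_pm_scale: "f - g = f + pm_scale (-1) g"
  by (rule poly_mapping_eqI) (simp add: lookup_add lookup_minus)

lemma pm_scale_single: "pm_scale c (Poly_Mapping.single p d) = Poly_Mapping.single p (c * d)"
  by (rule poly_mapping_eqI) (simp add: lookup_single when_def)

lemma finite_support_induct [consumes 2, case_names single add]:
  fixes f :: "'k \<Rightarrow>\<^sub>0 complex"
  assumes "Poly_Mapping.keys f \<subseteq> S"
    and "S \<noteq> {}"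
    and single: "\<And>p c. p \<in> S \<Longrightarrow> Q (Poly_Mapping.single p c)"
    and add: "\<And>f g. Poly_Mapping.keys f \<subseteq> S \<Longrightarrow> Poly_Mapping.keys g \<subseteq> S
      \<Longrightarrow> Q f \<Longrightarrow> Q g \<Longrightarrow> Q (f + g)"
  shows "Q f"
proof -
  obtain s where "s \<in> S" using assms(2) by blast
  \<comment> \<open>The zero function arises as a single with coefficient 0, which needs some key in
    \<open>S\<close>; this is the purpose of the nonemptiness assumption.\<close>
  then have zero: "Q 0" using single[of s 0] by simp
  have "Q g" if "Poly_Mapping.keys g \<subseteq> K" "finite K" "K \<subseteq> S" for g K
    using that(2,1,3)
  proof (induction K arbitrary: g)
    case empty
    then show ?case using zero by simp
  next
    case (insert p K)
    \<comment> \<open>Removing the coefficient at \<open>p\<close> leaves a function supported in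
      the smaller set.\<close>
    define h where "h = g - Poly_Mapping.single p (Poly_Mapping.lookup g p)"
    have h: "Poly_Mapping.keys h \<subseteq> K"
    proof
      fix r assume r: "r \<in> Poly_Mapping.keys h"
      then have "r \<noteq> p" by (auto simp: h_def in_keys_iff lookup_minus)
      moreover have "r \<in> Poly_Mapping.keys g"
        using r \<open>r \<noteq> p\<close> by (auto simp: h_def in_keys_iff lookup_minus lookup_single)
      ultimately show "r \<in> K" using insert.prems by blast
    qed
    have "Q (h + Poly_Mapping.single p (Poly_Mapping.lookup g p))"
      by (rule add) (use insert h single in auto)
    then show ?case by (simp add: h_def)
  qed
  from this[of f "Poly_Mapping.keys f"] show ?thesis using assms(1) by simp
qed

subsection \<open>The free vector space\<close>

text \<open>The linear extension of a function on basis elements. \<open>tensor_lift\<close> is this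
  sum taken at \<open>tensor_rep\<close>, so its linear algebra can be settled here, before any
  choice of representative is involved.\<close>

definition free_lift ::
    "(complex, 'p) module \<Rightarrow> ('k \<Rightarrow> 'p) \<Rightarrow> ('k \<Rightarrow>\<^sub>0 complex) \<Rightarrow> 'p" where
  "free_lift P \<gamma> f = (\<Oplus>\<^bsub>P\<^esub>p\<in>Poly_Mapping.keys f. Poly_Mapping.lookup f p \<odot>\<^bsub>P\<^esub> \<gamma> p)"

context
  fixes P :: "(complex, 'p) module" and \<gamma> :: "'k \<Rightarrow> 'p" and S :: "'k set"
  assumes P: "module complex_alg P" and \<gamma>_funcset: "\<gamma> \<in> S \<rightarrow> carrier P"
begin

interpretation P: module complex_alg P by (fact P)

private lemma \<gamma>: "p \<in> S \<Longrightarrow> \<gamma> p \<in> carrier P"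
  using \<gamma>_funcset by auto

text \<open>Cancellation can make the support of a sum smaller than the union of the supports.
  Padding with zero terms lets all sums involved run over one common index set.\<close>

lemma free_lift_superset:
  assumes "finite K" "Poly_Mapping.keys f \<subseteq> K" "K \<subseteq> S"
  shows "free_lift P \<gamma> f = (\<Oplus>\<^bsub>P\<^esub>p\<in>K. Poly_Mapping.lookup f p \<odot>\<^bsub>P\<^esub> \<gamma> p)"
  unfolding free_lift_def
  by (rule P.add.finprod_mono_neutral_cong_left)
     (use assms \<gamma> P.smult_l_null P.smult_closed in \<open>auto simp: in_keys_iff subset_iff\<close>)

lemma free_lift_closed:
  assumes "Poly_Mapping.keys f \<subseteq> S"
  shows "free_lift P \<gamma> f \<in> carrier P"
  unfolding free_lift_def
  by (rule P.finsum_closed) (use assms \<gamma> P.smult_closed in auto)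

lemma free_lift_add:
  assumes "Poly_Mapping.keys f \<subseteq> S" "Poly_Mapping.keys g \<subseteq> S"
  shows "free_lift P \<gamma> (f + g) = free_lift P \<gamma> f \<oplus>\<^bsub>P\<^esub> free_lift P \<gamma> g"
proof -
  let ?K = "Poly_Mapping.keys f \<union> Poly_Mapping.keys g"
  have K: "finite ?K" "?K \<subseteq> S" using assms by auto
  have "free_lift P \<gamma> (f + g) = (\<Oplus>\<^bsub>P\<^esub>p\<in>?K. Poly_Mapping.lookup (f + g) p \<odot>\<^bsub>P\<^esub> \<gamma> p)"
    by (rule free_lift_superset) (use K in \<open>auto dest: keys_add[THEN subsetD]\<close>)
  also have "\<dots> = (\<Oplus>\<^bsub>P\<^esub>p\<in>?K. Poly_Mapping.lookup f p \<odot>\<^bsub>P\<^esub> \<gamma> p \<oplus>\<^bsub>P\<^esub> Poly_Mapping.lookup g p \<odot>\<^bsub>P\<^esub> \<gamma> p)"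
    by (rule P.finsum_cong')
       (use K \<gamma> P.smult_closed P.smult_l_distr in \<open>auto simp: lookup_add subset_iff\<close>)
  also have "\<dots> = (\<Oplus>\<^bsub>P\<^esub>p\<in>?K. Poly_Mapping.lookup f p \<odot>\<^bsub>P\<^esub> \<gamma> p) \<oplus>\<^bsub>P\<^esub> (\<Oplus>\<^bsub>P\<^esub>p\<in>?K. Poly_Mapping.lookup g p \<odot>\<^bsub>P\<^esub> \<gamma> p)"
    by (rule P.finsum_addf) (use K \<gamma> P.smult_closed in \<open>auto simp: subset_iff\<close>)
  also have "\<dots> = free_lift P \<gamma> f \<oplus>\<^bsub>P\<^esub> free_lift P \<gamma> g"
    using free_lift_superset[OF K(1) _ K(2), of f] free_lift_superset[OF K(1) _ K(2), of g] by simp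
  finally show ?thesis .
qed

lemma free_lift_scale:
  assumes "Poly_Mapping.keys f \<subseteq> S"
  shows "free_lift P \<gamma> (pm_scale c f) = c \<odot>\<^bsub>P\<^esub> free_lift P \<gamma> f"
proof -
  let ?K = "Poly_Mapping.keys f"
  have "free_lift P \<gamma> (pm_scale c f) = (\<Oplus>\<^bsub>P\<^esub>p\<in>?K. Poly_Mapping.lookup (pm_scale c f) p \<odot>\<^bsub>P\<^esub> \<gamma> p)"
    by (rule free_lift_superset) (use assms in \<open>auto dest: keys_pm_scale[THEN subsetD]\<close>)
  also have "\<dots> = (\<Oplus>\<^bsub>P\<^esub>p\<in>?K. c \<odot>\<^bsub>P\<^esub> (Poly_Mapping.lookup f p \<odot>\<^bsub>P\<^esub> \<gamma> p))"
    by (rule P.finsum_cong')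
       (use assms \<gamma> P.smult_closed P.smult_assoc1 in \<open>auto simp: subset_iff\<close>)
  also have "\<dots> = c \<odot>\<^bsub>P\<^esub> free_lift P \<gamma> f"
    unfolding free_lift_def
    by (rule P.finsum_smult_ldistr[symmetric]) (use assms \<gamma> P.smult_closed in \<open>auto simp: subset_iff\<close>)
  finally show ?thesis .
qed

lemma free_lift_single:
  assumes "p \<in> S"
  shows "free_lift P \<gamma> (Poly_Mapping.single p c) = c \<odot>\<^bsub>P\<^esub> \<gamma> p"
proof -
  have "free_lift P \<gamma> (Poly_Mapping.single p c)
      = (\<Oplus>\<^bsub>P\<^esub>r\<in>{p}. Poly_Mapping.lookup (Poly_Mapping.single p c) r \<odot>\<^bsub>P\<^esub> \<gamma> r)"
    by (rule free_lift_superset) (use assms in auto)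
  also have "\<dots> = Poly_Mapping.lookup (Poly_Mapping.single p c) p \<odot>\<^bsub>P\<^esub> \<gamma> p"
    using assms \<gamma> P.smult_closed by (subst P.finsum_insert) auto
  finally show ?thesis by simp
qed

lemma free_lift_diff:
  assumes "Poly_Mapping.keys f \<subseteq> S" "Poly_Mapping.keys g \<subseteq> S"
  shows "free_lift P \<gamma> (f - g) = free_lift P \<gamma> f \<ominus>\<^bsub>P\<^esub> free_lift P \<gamma> g"
proof -
  have "free_lift P \<gamma> (f - g) = free_lift P \<gamma> f \<oplus>\<^bsub>P\<^esub> (- 1) \<odot>\<^bsub>P\<^esub> free_lift P \<gamma> g"
    unfolding diff_pm_scale using assms keys_pm_scale[of "-1" g]
    by (subst free_lift_add) (auto simp: free_lift_scale)
  \<comment> \<open>The module rule for negatives speaks of the additive inverse in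
    \<open>complex_alg\<close>, which the next step identifies with the number
    \<open>-1\<close>.\<close>
  moreover have "(\<ominus>\<^bsub>complex_alg\<^esub> 1) \<odot>\<^bsub>P\<^esub> free_lift P \<gamma> g = \<ominus>\<^bsub>P\<^esub> free_lift P \<gamma> g"
    using P.smult_l_minus[of 1] free_lift_closed[OF assms(2)] P.smult_one by simp
  moreover have "\<ominus>\<^bsub>complex_alg\<^esub> 1 = -1"
    by (rule P.R.minus_equality) auto
  ultimately show ?thesis by (simp add: a_minus_def)
qed

end

context
  fixes P :: "(complex, 'p) module"
  assumes P: "module complex_alg P"
begin

interpretation P: module complex_alg P by (fact P)

lemma linear_maps_sum:
  assumes "\<phi> \<in> linear_maps M P" "\<psi> \<in> linear_maps M P"
  shows "(\<lambda>u. \<phi> u \<oplus>\<^bsub>P\<^esub> \<psi> u) \<in> linear_maps M P"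
  using P.smult_r_distr linear_mapsD[OF assms(1)] linear_mapsD[OF assms(2)]
  by (auto intro!: linear_mapsI simp: P.M.a_ac)

text \<open>Compatibility with scalars holds because the scalars commute with each other.\<close>

lemma linear_maps_scaled:
  assumes "\<phi> \<in> linear_maps M P"
  shows "(\<lambda>u. c \<odot>\<^bsub>P\<^esub> \<phi> u) \<in> linear_maps M P"
  using P.smult_r_distr P.smult_closed P.smult_assoc1[of c, symmetric] P.smult_assoc1[of _ c, symmetric] linear_mapsD[OF assms]
  by (auto intro!: linear_mapsI simp: mult.commute)

end

subsection \<open>Tensor products and their universal property\<close>

context
  fixes M :: "(complex, 'a) module" and N :: "(complex, 'b) module"
  assumes M: "module complex_alg M" and N: "module complex_alg N"
begin

interpretation M: module complex_alg M by (fact M)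
interpretation N: module complex_alg N by (fact N)

text \<open>The generators involve elements of the carriers only, and neither sums nor scalings
  leave that support. Consequently the arbitrary choice in \<open>tensor_rep\<close> cannot pick a
  function with keys outside the carriers when the class comes from one supported inside.\<close>

lemma tensor_null_keys:
  assumes "f \<in> tensor_null M N"
  shows "Poly_Mapping.keys f \<subseteq> carrier M \<times> carrier N"
  using assms
proof induction
  case (add f g)
  then show ?case using keys_add[of f g] by blast
next
  case (scale f c)
  then show ?case using keys_pm_scale[of c f] by blast
qed (use M.smult_closed N.smult_closed in
    \<open>auto dest!: keys_diff[THEN subsetD] split: if_splits\<close>)

lemma tensor_null_diff:
  assumes "f \<in> tensor_null M N" "g \<in> tensor_null M N"
  shows "f - g \<in> tensor_null M N"
  unfolding diff_pm_scale by (intro tensor_null.add tensor_null.scale assms)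

lemma tensor_class_eq_iff:
  "tensor_class M N f = tensor_class M N g \<longleftrightarrow> f - g \<in> tensor_null M N"
proof
  assume "tensor_class M N f = tensor_class M N g"
  moreover have "f \<in> tensor_class M N f"
    by (simp add: tensor_class_def tensor_null.zero)
  ultimately show "f - g \<in> tensor_null M N" by (simp add: tensor_class_def)
next
  assume fg: "f - g \<in> tensor_null M N"
  have "h - f \<in> tensor_null M N \<longleftrightarrow> h - g \<in> tensor_null M N" for h
    using tensor_null.add[OF _ fg, of "h - f"] tensor_null_diff[OF _ fg, of "h - g"] by auto
  then show "tensor_class M N f = tensor_class M N g" by (simp add: tensor_class_def)
qed

text \<open>All later knowledge about the chosen representative derives from this
  congruence.\<close>

lemma tensor_rep_class: "tensor_rep (tensor_class M N f) - f \<in> tensor_null M N"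
proof -
  have "f \<in> tensor_class M N f"
    by (simp add: tensor_class_def tensor_null.zero)
  then have "tensor_rep (tensor_class M N f) \<in> tensor_class M N f"
    unfolding tensor_rep_def by (rule someI)
  then show ?thesis by (simp add: tensor_class_def)
qed

lemma tensor_rep_keys:
  assumes "Poly_Mapping.keys f \<subseteq> carrier M \<times> carrier N"
  shows "Poly_Mapping.keys (tensor_rep (tensor_class M N f)) \<subseteq> carrier M \<times> carrier N"
  using keys_add[of "tensor_rep (tensor_class M N f) - f" f]
    tensor_null_keys[OF tensor_rep_class[of f]] assms by auto

lemma tensor_class_closed:
  "Poly_Mapping.keys f \<subseteq> carrier M \<times> carrier N \<Longrightarrow> tensor_class M N f \<in> carrier (tensor M N)"
  by (auto simp: tensor_def)

lemma tensor_carrierE: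
  assumes "T \<in> carrier (tensor M N)"
  obtains f where "Poly_Mapping.keys f \<subseteq> carrier M \<times> carrier N" "T = tensor_class M N f"
  using assms by (auto simp: tensor_def)

text \<open>Well-definedness of the sum: the chosen representatives are off by two null elements,
  whose sum is null again.\<close>

lemma tensor_class_add:
  "tensor_class M N f \<oplus>\<^bsub>tensor M N\<^esub> tensor_class M N g = tensor_class M N (f + g)"
  using tensor_null.add[OF tensor_rep_class[of f] tensor_rep_class[of g]]
  by (simp add: tensor_def tensor_class_eq_iff algebra_simps)

lemma tensor_class_smult:
  "c \<odot>\<^bsub>tensor M N\<^esub> tensor_class M N f = tensor_class M N (pm_scale c f)"
  using tensor_null.scale[OF tensor_rep_class[of f], of c]
  by (simp add: tensor_def tensor_class_eq_iff pm_scale_diff)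

lemma tensor_zero: "\<zero>\<^bsub>tensor M N\<^esub> = tensor_class M N 0"
  by (simp add: tensor_def)

text \<open>The module laws hold for finitely supported functions and pass to classes, since sums
  and multiples may now be computed on any representative.\<close>

lemma module_tensor: "module complex_alg (tensor M N)"
proof (rule moduleI)
  show "cring complex_alg" by (rule M.R.is_cring)
  show "abelian_group (tensor M N)"
  proof (rule abelian_groupI)
    fix T U assume "T \<in> carrier (tensor M N)" "U \<in> carrier (tensor M N)"
    then obtain f g where fg: "Poly_Mapping.keys f \<subseteq> carrier M \<times> carrier N" "T = tensor_class M N f"
      "Poly_Mapping.keys g \<subseteq> carrier M \<times> carrier N" "U = tensor_class M N g"
      by (metis tensor_carrierE)
    then show "T \<oplus>\<^bsub>tensor M N\<^esub> U \<in> carrier (tensor M N)"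
      using keys_add[of f g] by (auto simp: tensor_class_add intro!: tensor_class_closed)
    show "T \<oplus>\<^bsub>tensor M N\<^esub> U = U \<oplus>\<^bsub>tensor M N\<^esub> T"
      using fg by (simp add: tensor_class_add add.commute)
    fix V assume "V \<in> carrier (tensor M N)"
    then obtain h where "V = tensor_class M N h" by (metis tensor_carrierE)
    then show "(T \<oplus>\<^bsub>tensor M N\<^esub> U) \<oplus>\<^bsub>tensor M N\<^esub> V = T \<oplus>\<^bsub>tensor M N\<^esub> (U \<oplus>\<^bsub>tensor M N\<^esub> V)"
      using fg by (simp add: tensor_class_add add.assoc)
  next
    fix T assume "T \<in> carrier (tensor M N)"
    then obtain f where f: "Poly_Mapping.keys f \<subseteq> carrier M \<times> carrier N" "T = tensor_class M N f"
      by (metis tensor_carrierE)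
    then show "\<zero>\<^bsub>tensor M N\<^esub> \<oplus>\<^bsub>tensor M N\<^esub> T = T"
      by (simp add: tensor_zero tensor_class_add)
    show "\<exists>U\<in>carrier (tensor M N). U \<oplus>\<^bsub>tensor M N\<^esub> T = \<zero>\<^bsub>tensor M N\<^esub>"
      by (rule bexI[of _ "tensor_class M N (- f)"])
         (use f in \<open>auto simp: tensor_zero tensor_class_add intro!: tensor_class_closed\<close>)
  qed (simp add: tensor_zero tensor_class_closed)
next
  fix a T assume "T \<in> carrier (tensor M N)"
  then obtain f where f: "Poly_Mapping.keys f \<subseteq> carrier M \<times> carrier N" "T = tensor_class M N f"
    by (metis tensor_carrierE)
  show "a \<odot>\<^bsub>tensor M N\<^esub> T \<in> carrier (tensor M N)"
    using f keys_pm_scale[of a f] by (auto simp: tensor_class_smult intro!: tensor_class_closed)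
  show "\<one>\<^bsub>complex_alg\<^esub> \<odot>\<^bsub>tensor M N\<^esub> T = T"
    using f by (simp add: tensor_class_smult) (rule arg_cong[of _ _ "tensor_class M N"],
      rule poly_mapping_eqI, simp)
  fix b
  have "pm_scale (a + b) f = pm_scale a f + pm_scale b f"
    by (rule poly_mapping_eqI) (simp add: lookup_add algebra_simps)
  then show "(a \<oplus>\<^bsub>complex_alg\<^esub> b) \<odot>\<^bsub>tensor M N\<^esub> T = a \<odot>\<^bsub>tensor M N\<^esub> T \<oplus>\<^bsub>tensor M N\<^esub> b \<odot>\<^bsub>tensor M N\<^esub> T"
    using f by (simp add: tensor_class_smult tensor_class_add)
  have "pm_scale (a * b) f = pm_scale a (pm_scale b f)"
    by (rule poly_mapping_eqI) simp
  then show "(a \<otimes>\<^bsub>complex_alg\<^esub> b) \<odot>\<^bsub>tensor M N\<^esub> T = a \<odot>\<^bsub>tensor M N\<^esub> (b \<odot>\<^bsub>tensor M N\<^esub> T)"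
    using f by (simp add: tensor_class_smult)
  fix U assume "U \<in> carrier (tensor M N)"
  then obtain g where "U = tensor_class M N g" by (metis tensor_carrierE)
  then show "a \<odot>\<^bsub>tensor M N\<^esub> (T \<oplus>\<^bsub>tensor M N\<^esub> U) = a \<odot>\<^bsub>tensor M N\<^esub> T \<oplus>\<^bsub>tensor M N\<^esub> a \<odot>\<^bsub>tensor M N\<^esub> U"
    using f by (simp add: tensor_class_smult tensor_class_add pm_scale_add)
qed

text \<open>The four families of generators of \<open>tensor_null\<close> are precisely these
  identities; \<open>diff_diff_eq\<close> brings the additive ones into the shape in which they are
  generated.\<close>

lemma pure_tensor_bilinear: "pure_tensor M N \<in> bilinear_maps M N (tensor M N)"
proof (rule bilinear_mapsI)
  fix u assume u: "u \<in> carrier M"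
  show "pure_tensor M N u \<in> linear_maps N (tensor M N)"
    unfolding pure_tensor_def
    by (rule linear_mapsI)
       (use u tensor_null.add_right[where M = M and N = N] tensor_null.smult_right[where M = M and N = N] in
        \<open>auto intro!: tensor_class_closed
          simp: tensor_class_add tensor_class_smult tensor_class_eq_iff pm_scale_single diff_diff_eq\<close>)
next
  fix v assume v: "v \<in> carrier N"
  show "(\<lambda>u. pure_tensor M N u v) \<in> linear_maps M (tensor M N)"
    unfolding pure_tensor_def
    by (rule linear_mapsI)
       (use v tensor_null.add_left[where M = M and N = N] tensor_null.smult_left[where M = M and N = N] in
        \<open>auto intro!: tensor_class_closed
          simp: tensor_class_add tensor_class_smult tensor_class_eq_iff pm_scale_single diff_diff_eq\<close>)
qed

lemma pure_tensor_closed: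
  "u \<in> carrier M \<Longrightarrow> v \<in> carrier N \<Longrightarrow> pure_tensor M N u v \<in> carrier (tensor M N)"
  using bilinear_maps_closed[OF pure_tensor_bilinear] .

lemma tensor_class_single:
  "tensor_class M N (Poly_Mapping.single p c)
    = c \<odot>\<^bsub>tensor M N\<^esub> pure_tensor M N (fst p) (snd p)"
  by (simp add: pure_tensor_def tensor_class_smult pm_scale_single)

lemma tensor_induct [consumes 1, case_names pure add smult]:
  assumes "T \<in> carrier (tensor M N)"
    and pure: "\<And>u v. u \<in> carrier M \<Longrightarrow> v \<in> carrier N \<Longrightarrow> Q (pure_tensor M N u v)"
    and add: "\<And>T U. T \<in> carrier (tensor M N) \<Longrightarrow> U \<in> carrier (tensor M N) \<Longrightarrow> Q T \<Longrightarrow> Q U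
      \<Longrightarrow> Q (T \<oplus>\<^bsub>tensor M N\<^esub> U)"
    and smult: "\<And>c T. T \<in> carrier (tensor M N) \<Longrightarrow> Q T \<Longrightarrow> Q (c \<odot>\<^bsub>tensor M N\<^esub> T)"
  shows "Q T"
proof -
  obtain f where f: "Poly_Mapping.keys f \<subseteq> carrier M \<times> carrier N" "T = tensor_class M N f"
    using assms(1) by (metis tensor_carrierE)
  \<comment> \<open>Both modules contain their zero.\<close>
  have "carrier M \<times> carrier N \<noteq> {}" by auto
  from f(1) this have "Q (tensor_class M N f)"
  proof (induction rule: finite_support_induct)
    case (single p c)
    then show ?case
      by (auto simp: tensor_class_single intro!: smult pure pure_tensor_closed)
  next
    case (add f g)
    then show ?case
      by (auto simp: tensor_class_add[symmetric] intro!: assms(3) tensor_class_closed)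
  qed
  then show ?thesis using f by simp
qed

text \<open>The uniqueness half of the universal property: pure tensors span, so they determine a
  linear map.\<close>

lemma tensor_maps_eqI:
  assumes "\<phi> \<in> linear_maps (tensor M N) P" "\<psi> \<in> linear_maps (tensor M N) P"
    and "T \<in> carrier (tensor M N)"
    and "\<And>u v. u \<in> carrier M \<Longrightarrow> v \<in> carrier N
      \<Longrightarrow> \<phi> (pure_tensor M N u v) = \<psi> (pure_tensor M N u v)"
  shows "\<phi> T = \<psi> T"
  using assms(3)
  by (induction rule: tensor_induct)
     (use assms(1,2,4) in \<open>simp_all add: linear_maps_add linear_maps_smult\<close>)

section \<open>Existence in the universal property: bilinear maps induce linear maps\<close>

context
  fixes P :: "(complex, 'p) module"
  assumes P: "module complex_alg P"
begin

interpretation P: module complex_alg P by (fact P)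

context
  fixes \<beta> :: "'a \<Rightarrow> 'b \<Rightarrow> 'p"
  assumes \<beta>: "\<beta> \<in> bilinear_maps M N P"
begin

private lemma bilinear_closed:
  "(\<lambda>p. \<beta> (fst p) (snd p)) \<in> carrier M \<times> carrier N \<rightarrow> carrier P"
  using bilinear_maps_closed[OF \<beta>] by auto

private lemmas lift_closed = free_lift_closed[OF P bilinear_closed]
  and lift_add = free_lift_add[OF P bilinear_closed]
  and lift_scale = free_lift_scale[OF P bilinear_closed]
  and lift_diff = free_lift_diff[OF P bilinear_closed]
  and lift_single = free_lift_single[OF P bilinear_closed]

text \<open>Bilinearity of \<beta> says that its linear extension kills every generator of
  \<open>tensor_null\<close>, and the kernel of a linear map is closed under sums and
  scaling.\<close>

lemma free_lift_null:
  assumes "f \<in> tensor_null M N"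
  shows "free_lift P (\<lambda>p. \<beta> (fst p) (snd p)) f = \<zero>\<^bsub>P\<^esub>"
proof -
  note fl = lift_add lift_diff lift_scale lift_single
  have kd: "Poly_Mapping.keys (f - g) \<subseteq> carrier M \<times> carrier N"
    if "Poly_Mapping.keys f \<subseteq> carrier M \<times> carrier N" "Poly_Mapping.keys g \<subseteq> carrier M \<times> carrier N"
    for f g :: "'a \<times> 'b \<Rightarrow>\<^sub>0 complex"
    using that keys_diff[of f g] by auto
  have ks: "Poly_Mapping.keys (Poly_Mapping.single (u, v) c) \<subseteq> carrier M \<times> carrier N"
    if "u \<in> carrier M" "v \<in> carrier N" for u v and c :: complex
    using that by auto
  have one: "1 \<odot>\<^bsub>P\<^esub> x = x" if "x \<in> carrier P" for x
    using P.smult_one[OF that] by simp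
  \<comment> \<open>\<open>canc2\<close> is the shape left by the two scalar generators,
    \<open>canc\<close> the shape left by the two additive ones.\<close>
  have canc2: "x \<ominus>\<^bsub>P\<^esub> x = \<zero>\<^bsub>P\<^esub>" if "x \<in> carrier P" for x
    using that by (simp add: a_minus_def P.M.r_neg)
  have canc: "(x \<oplus>\<^bsub>P\<^esub> y) \<ominus>\<^bsub>P\<^esub> x \<ominus>\<^bsub>P\<^esub> y = \<zero>\<^bsub>P\<^esub>"
    if "x \<in> carrier P" "y \<in> carrier P" for x y
  proof -
    have "(x \<oplus>\<^bsub>P\<^esub> y) \<ominus>\<^bsub>P\<^esub> x = y"
      using that by (simp add: a_minus_def P.M.a_comm[of x y] P.M.a_assoc P.M.r_neg)
    then show "(x \<oplus>\<^bsub>P\<^esub> y) \<ominus>\<^bsub>P\<^esub> x \<ominus>\<^bsub>P\<^esub> y = \<zero>\<^bsub>P\<^esub>"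
      using that by (simp add: a_minus_def P.M.r_neg)
  qed
  show ?thesis
    using assms
  proof induction
    case zero
    show ?case by (simp add: free_lift_def)
  next
    case (add f g)
    then show ?case by (simp add: fl(1) tensor_null_keys)
  next
    case (scale f c)
    then show ?case using P.smult_r_null[of c] by (simp add: fl(3) tensor_null_keys)
  next
    case (add_left u u' v)
    then show ?case
      by (simp add: fl(2,4) kd ks one bilinear_mapsD[OF \<beta>] canc canc2 del: Poly_Mapping.keys_single)
  next
    case (add_right u v v')
    then show ?case
      by (simp add: fl(2,4) kd ks one bilinear_mapsD[OF \<beta>] canc canc2 del: Poly_Mapping.keys_single)
  next
    case (smult_left u v c)
    moreover have "\<beta> (c \<odot>\<^bsub>M\<^esub> u) v \<in> carrier P" "c \<odot>\<^bsub>M\<^esub> u \<in> carrier M"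
      using smult_left M.smult_closed[of c u] bilinear_maps_closed[OF \<beta>] by auto
    ultimately show ?case
      by (simp add: fl(2,4) kd ks one bilinear_mapsD[OF \<beta>] canc canc2 del: Poly_Mapping.keys_single)
  next
    case (smult_right u v c)
    moreover have "\<beta> u (c \<odot>\<^bsub>N\<^esub> v) \<in> carrier P" "c \<odot>\<^bsub>N\<^esub> v \<in> carrier N"
      using smult_right N.smult_closed[of c v] bilinear_maps_closed[OF \<beta>] by auto
    ultimately show ?case
      by (simp add: fl(2,4) kd ks one bilinear_mapsD[OF \<beta>] canc canc2 del: Poly_Mapping.keys_single)
  qed
qed

text \<open>Independence of the representative: the chosen one equals \<open>f\<close> plus a null
  element, which contributes zero. From here on a lift can be evaluated on any representative
  supported in the carriers.\<close>

lemma tensor_lift_class: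
  assumes "Poly_Mapping.keys f \<subseteq> carrier M \<times> carrier N"
  shows "tensor_lift P \<beta> (tensor_class M N f) = free_lift P (\<lambda>p. \<beta> (fst p) (snd p)) f"
proof -
  let ?r = "tensor_rep (tensor_class M N f)"
  have "free_lift P (\<lambda>p. \<beta> (fst p) (snd p)) (?r - f + f)
      = \<zero>\<^bsub>P\<^esub> \<oplus>\<^bsub>P\<^esub> free_lift P (\<lambda>p. \<beta> (fst p) (snd p)) f"
    using lift_add[OF tensor_null_keys[OF tensor_rep_class[of f]] assms]
      free_lift_null[OF tensor_rep_class[of f]] by simp
  then show ?thesis
    using lift_closed[OF assms] by (simp add: tensor_lift_def free_lift_def)
qed

lemma tensor_lift_linear: "tensor_lift P \<beta> \<in> linear_maps (tensor M N) P"
proof (rule linear_mapsI)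
  fix T assume "T \<in> carrier (tensor M N)"
  then obtain f where f: "Poly_Mapping.keys f \<subseteq> carrier M \<times> carrier N" "T = tensor_class M N f"
    by (metis tensor_carrierE)
  show "tensor_lift P \<beta> T \<in> carrier P"
    using f by (simp add: tensor_lift_class lift_closed)
  show "tensor_lift P \<beta> (c \<odot>\<^bsub>tensor M N\<^esub> T) = c \<odot>\<^bsub>P\<^esub> tensor_lift P \<beta> T" for c
    using f subset_trans[OF keys_pm_scale f(1)]
    by (simp add: tensor_class_smult tensor_lift_class lift_scale)
  fix U assume "U \<in> carrier (tensor M N)"
  then obtain g where g: "Poly_Mapping.keys g \<subseteq> carrier M \<times> carrier N" "U = tensor_class M N g"
    by (metis tensor_carrierE)
  have "Poly_Mapping.keys (f + g) \<subseteq> carrier M \<times> carrier N"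
    using f(1) g(1) keys_add[of f g] by blast
  then show "tensor_lift P \<beta> (T \<oplus>\<^bsub>tensor M N\<^esub> U) = tensor_lift P \<beta> T \<oplus>\<^bsub>P\<^esub> tensor_lift P \<beta> U"
    using f g by (simp add: tensor_class_add tensor_lift_class lift_add)
qed

lemma tensor_lift_pure:
  assumes "u \<in> carrier M" "v \<in> carrier N"
  shows "tensor_lift P \<beta> (pure_tensor M N u v) = \<beta> u v"
proof -
  have "free_lift P (\<lambda>p. \<beta> (fst p) (snd p)) (Poly_Mapping.single (u, v) 1) = 1 \<odot>\<^bsub>P\<^esub> \<beta> u v"
    using lift_single[of "(u, v)" 1] assms by auto
  then show ?thesis
    using assms P.smult_one[of "\<beta> u v"] bilinear_maps_closed[OF \<beta>]
    by (simp add: pure_tensor_def tensor_lift_class)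
qed

end

text \<open>The chosen representative is supported in the carriers, so values elsewhere are never
  seen. Bilinearity is asked of one side only: it places the summands in \<open>carrier P\<close>,
  and the other side inherits this by equality.\<close>

lemma tensor_lift_cong:
  assumes "T \<in> carrier (tensor M N)" "\<beta> \<in> bilinear_maps M N P"
    and "\<And>u v. u \<in> carrier M \<Longrightarrow> v \<in> carrier N \<Longrightarrow> \<beta> u v = \<beta>' u v"
  shows "tensor_lift P \<beta> T = tensor_lift P \<beta>' T"
proof -
  have "Poly_Mapping.keys (tensor_rep T) \<subseteq> carrier M \<times> carrier N"
    using assms(1) by (metis tensor_carrierE tensor_rep_keys)
  then show ?thesis
    unfolding tensor_lift_def
    by (intro P.finsum_cong')
       (use assms(3) bilinear_maps_closed[OF assms(2)] P.smult_closed in \<open>auto simp: subset_iff\<close>)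
qed

end

end

subsection \<open>Naturality\<close>

lemma tensor_lift_comp:
  assumes "module complex_alg M" "module complex_alg N" "module complex_alg P" "module complex_alg Q"
    and \<beta>: "\<beta> \<in> bilinear_maps M N P" and \<phi>: "\<phi> \<in> linear_maps P Q"
    and T: "T \<in> carrier (tensor M N)"
  shows "\<phi> (tensor_lift P \<beta> T) = tensor_lift Q (\<lambda>u v. \<phi> (\<beta> u v)) T"
  by (rule tensor_maps_eqI[OF assms(1,2) linear_maps_comp[OF tensor_lift_linear[OF assms(1-3) \<beta>] \<phi>]
        tensor_lift_linear[OF assms(1,2,4) linear_bilinear_comp[OF \<beta> \<phi>]] T])
     (simp add: tensor_lift_pure[OF assms(1-3) \<beta>]
        tensor_lift_pure[OF assms(1,2,4) linear_bilinear_comp[OF \<beta> \<phi>]])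

lemma tensor_lift_add:
  assumes "module complex_alg M" "module complex_alg N" "module complex_alg P"
    and \<beta>: "\<beta> \<in> bilinear_maps M N P" and \<beta>': "\<beta>' \<in> bilinear_maps M N P"
    and T: "T \<in> carrier (tensor M N)"
  shows "tensor_lift P (\<lambda>u v. \<beta> u v \<oplus>\<^bsub>P\<^esub> \<beta>' u v) T = tensor_lift P \<beta> T \<oplus>\<^bsub>P\<^esub> tensor_lift P \<beta>' T"
proof -
  have s: "(\<lambda>u v. \<beta> u v \<oplus>\<^bsub>P\<^esub> \<beta>' u v) \<in> bilinear_maps M N P"
    using bilinear_mapsD(1,2)[OF \<beta>] bilinear_mapsD(1,2)[OF \<beta>']
    by (intro bilinear_mapsI linear_maps_sum assms(3))
  show ?thesis
    by (rule tensor_maps_eqI[OF assms(1,2) tensor_lift_linear[OF assms(1-3) s]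
          linear_maps_sum[OF assms(3) tensor_lift_linear[OF assms(1-3) \<beta>]
            tensor_lift_linear[OF assms(1-3) \<beta>']] T])
       (simp add: tensor_lift_pure[OF assms(1-3)] s \<beta> \<beta>')
qed

text \<open>Scaling by \<open>c\<close> is a linear endomorphism of \<open>P\<close>, which makes
  this an instance of \<open>tensor_lift_comp\<close>.\<close>

lemma tensor_lift_smult:
  assumes "module complex_alg M" "module complex_alg N" "module complex_alg P"
    and \<beta>: "\<beta> \<in> bilinear_maps M N P" and T: "T \<in> carrier (tensor M N)"
  shows "tensor_lift P (\<lambda>u v. c \<odot>\<^bsub>P\<^esub> \<beta> u v) T = c \<odot>\<^bsub>P\<^esub> tensor_lift P \<beta> T"
  using tensor_lift_comp[OF assms(1-3,3) \<beta> linear_maps_scaled[OF assms(3) linear_maps_id] T, of c]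
  by simp

text \<open>For a fixed tensor the lift is additive and homogeneous in the bilinear map itself,
  hence linear in any parameter on which that map depends linearly. This supplies the bilinearity
  needed whenever one lift is nested in another.\<close>

lemma tensor_lift_param_linear:
  assumes "module complex_alg M" "module complex_alg N" "module complex_alg P"
    and \<beta>: "\<And>w. w \<in> carrier L \<Longrightarrow> \<beta> w \<in> bilinear_maps M N P"
    and lin: "\<And>u v. u \<in> carrier M \<Longrightarrow> v \<in> carrier N \<Longrightarrow> (\<lambda>w. \<beta> w u v) \<in> linear_maps L P"
    and L: "module complex_alg L"
    and T: "T \<in> carrier (tensor M N)"
  shows "(\<lambda>w. tensor_lift P (\<beta> w) T) \<in> linear_maps L P"
proof -
  interpret L: module complex_alg L by (fact L)
  show ?thesis
  proof (rule linear_mapsI)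
    fix w assume w: "w \<in> carrier L"
    show "tensor_lift P (\<beta> w) T \<in> carrier P"
      using linear_maps_closed[OF tensor_lift_linear[OF assms(1-3) \<beta>[OF w]] T] .
    have "tensor_lift P (\<beta> (c \<odot>\<^bsub>L\<^esub> w)) T = tensor_lift P (\<lambda>u v. c \<odot>\<^bsub>P\<^esub> \<beta> w u v) T" for c
      by (rule tensor_lift_cong[OF assms(1-3) T])
         (use w L.smult_closed \<beta> linear_maps_smult[OF lin] in auto)
    then show "tensor_lift P (\<beta> (c \<odot>\<^bsub>L\<^esub> w)) T = c \<odot>\<^bsub>P\<^esub> tensor_lift P (\<beta> w) T" for c
      using tensor_lift_smult[OF assms(1-3) \<beta>[OF w] T] by simp
    fix w' assume w': "w' \<in> carrier L"
    have "tensor_lift P (\<beta> (w \<oplus>\<^bsub>L\<^esub> w')) T = tensor_lift P (\<lambda>u v. \<beta> w u v \<oplus>\<^bsub>P\<^esub> \<beta> w' u v) T"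
      by (rule tensor_lift_cong[OF assms(1-3) T])
         (use w w' \<beta> linear_maps_add[OF lin] in auto)
    then show "tensor_lift P (\<beta> (w \<oplus>\<^bsub>L\<^esub> w')) T = tensor_lift P (\<beta> w) T \<oplus>\<^bsub>P\<^esub> tensor_lift P (\<beta> w') T"
      using tensor_lift_add[OF assms(1-3) \<beta>[OF w] \<beta>[OF w'] T] by simp
  qed
qed

section \<open>Functoriality of the tensor product of maps\<close>

context
  fixes M' :: "(complex, 'c) module" and N' :: "(complex, 'd) module"
    and M :: "(complex, 'a) module" and N :: "(complex, 'b) module"
    and f g
  assumes mods: "module complex_alg M'" "module complex_alg N'"
    "module complex_alg M" "module complex_alg N"
    and fg: "f \<in> linear_maps M' M" "g \<in> linear_maps N' N"
begin

private lemma map_bilinear: "(\<lambda>u v. pure_tensor M N (f u) (g v)) \<in> bilinear_maps M' N' (tensor M N)"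
  by (rule bilinear_maps_comp[OF fg pure_tensor_bilinear[OF mods(3,4)]])

lemma tensor_map_linear: "tensor_map M N f g \<in> linear_maps (tensor M' N') (tensor M N)"
  unfolding tensor_map_def
  by (rule tensor_lift_linear[OF mods(1,2) module_tensor[OF mods(3,4)] map_bilinear])

lemma tensor_map_pure:
  "u \<in> carrier M' \<Longrightarrow> v \<in> carrier N'
    \<Longrightarrow> tensor_map M N f g (pure_tensor M' N' u v) = pure_tensor M N (f u) (g v)"
  unfolding tensor_map_def
  by (rule tensor_lift_pure[OF mods(1,2) module_tensor[OF mods(3,4)] map_bilinear])

lemma tensor_map_cong:
  assumes "T \<in> carrier (tensor M' N')"
    and "\<And>u. u \<in> carrier M' \<Longrightarrow> f u = f' u" "\<And>v. v \<in> carrier N' \<Longrightarrow> g v = g' v"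
  shows "tensor_map M N f g T = tensor_map M N f' g' T"
  unfolding tensor_map_def
  by (rule tensor_lift_cong[OF mods(1,2) module_tensor[OF mods(3,4)] assms(1) map_bilinear])
     (simp add: assms)

text \<open>Both sides are linear and send \<open>u \<otimes> v\<close> to
  \<open>\<beta> (f u) (g v)\<close>.\<close>

lemma tensor_lift_map:
  assumes P: "module complex_alg P" and \<beta>: "\<beta> \<in> bilinear_maps M N P"
    and T: "T \<in> carrier (tensor M' N')"
  shows "tensor_lift P \<beta> (tensor_map M N f g T) = tensor_lift P (\<lambda>u v. \<beta> (f u) (g v)) T"
  by (rule tensor_maps_eqI[OF mods(1,2)
        linear_maps_comp[OF tensor_map_linear tensor_lift_linear[OF mods(3,4) P \<beta>]]
        tensor_lift_linear[OF mods(1,2) P bilinear_maps_comp[OF fg \<beta>]] T])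
     (simp add: tensor_map_pure tensor_lift_pure[OF mods(3,4) P \<beta>] linear_maps_closed[OF fg(1)]
        linear_maps_closed[OF fg(2)] tensor_lift_pure[OF mods(1,2) P bilinear_maps_comp[OF fg \<beta>]])

text \<open>A \<open>tensor_map\<close> is itself a lift, so \<open>tensor_lift_map\<close> applies
  with the bilinear map that sends a pair to \<open>f' u \<otimes> g' v\<close>.\<close>

lemma tensor_map_comp:
  assumes PQ: "module complex_alg P" "module complex_alg Q"
    and fg': "f' \<in> linear_maps M P" "g' \<in> linear_maps N Q"
    and T: "T \<in> carrier (tensor M' N')"
  shows "tensor_map P Q f' g' (tensor_map M N f g T)
    = tensor_map P Q (\<lambda>u. f' (f u)) (\<lambda>v. g' (g v)) T"
  unfolding tensor_map_def[of P Q]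
  by (rule tensor_lift_map[OF module_tensor[OF PQ]
        bilinear_maps_comp[OF fg' pure_tensor_bilinear[OF PQ]] T])

end

section \<open>The associativity isomorphism\<close>

context
  fixes L :: "(complex, 'a) module" and M :: "(complex, 'b) module" and N :: "(complex, 'c) module"
  assumes mods: "module complex_alg L" "module complex_alg M" "module complex_alg N"
begin

lemma module_tensor3: "module complex_alg (tensor L (tensor M N))"
  by (intro module_tensor mods)

lemma tensor_assoc_inner_bilinear:
  assumes "w \<in> carrier N"
  shows "(\<lambda>u v. pure_tensor L (tensor M N) u (pure_tensor M N v w)) \<in> bilinear_maps L M (tensor L (tensor M N))"
  by (rule bilinear_maps_comp[OF linear_maps_id
        bilinear_mapsD(2)[OF pure_tensor_bilinear[OF mods(2,3)] assms]
        pure_tensor_bilinear[OF mods(1) module_tensor[OF mods(2,3)]]])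

text \<open>Linearity in \<open>t\<close> is that of the inner lift; linearity in \<open>w\<close>
  is the parameter dependence of that lift.\<close>

lemma tensor_assoc_bilinear:
  "(\<lambda>t w. tensor_lift (tensor L (tensor M N)) (\<lambda>u v. pure_tensor L (tensor M N) u (pure_tensor M N v w)) t)
    \<in> bilinear_maps (tensor L M) N (tensor L (tensor M N))"
proof (rule bilinear_mapsI)
  show "(\<lambda>t. tensor_lift (tensor L (tensor M N)) (\<lambda>u v. pure_tensor L (tensor M N) u (pure_tensor M N v w)) t)
      \<in> linear_maps (tensor L M) (tensor L (tensor M N))" if "w \<in> carrier N" for w
    by (rule tensor_lift_linear[OF mods(1,2) module_tensor3 tensor_assoc_inner_bilinear[OF that]])
  show "(\<lambda>w. tensor_lift (tensor L (tensor M N)) (\<lambda>u v. pure_tensor L (tensor M N) u (pure_tensor M N v w)) t)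
      \<in> linear_maps N (tensor L (tensor M N))" if "t \<in> carrier (tensor L M)" for t
  proof (rule tensor_lift_param_linear[OF mods(1,2) module_tensor3 tensor_assoc_inner_bilinear _ mods(3) that])
    fix u v assume "u \<in> carrier L" "v \<in> carrier M"
    then show "(\<lambda>w. pure_tensor L (tensor M N) u (pure_tensor M N v w)) \<in> linear_maps N (tensor L (tensor M N))"
      by (intro linear_maps_comp[OF bilinear_mapsD(1)[OF pure_tensor_bilinear[OF mods(2,3)]]
            bilinear_mapsD(1)[OF pure_tensor_bilinear[OF mods(1) module_tensor[OF mods(2,3)]]]])
  qed
qed

end

text \<open>On \<open>(u \<otimes> v) \<otimes> w\<close> both routes give
  \<open>f u \<otimes> (g v \<otimes> h w)\<close>. The two nested lifts are treated alike: the maps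
  on the source are absorbed into the integrand, and the map on the target is pulled out in
  front.\<close>

lemma tensor_assoc_natural:
  fixes L :: "(complex, 'a) module" and M :: "(complex, 'b) module" and N :: "(complex, 'c) module"
    and L' :: "(complex, 'd) module" and M' :: "(complex, 'e) module" and N' :: "(complex, 'f) module"
  assumes mods: "module complex_alg L" "module complex_alg M" "module complex_alg N"
    and mods': "module complex_alg L'" "module complex_alg M'" "module complex_alg N'"
    and fgh: "f \<in> linear_maps L L'" "g \<in> linear_maps M M'" "h \<in> linear_maps N N'"
    and T: "T \<in> carrier (tensor (tensor L M) N)"
  shows "tensor_assoc L' M' N' (tensor_map (tensor L' M') N' (tensor_map L' M' f g) h T)
    = tensor_map L' (tensor M' N') f (tensor_map M' N' g h) (tensor_assoc L M N T)"
proof -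
  note ab = tensor_assoc_inner_bilinear[OF mods'] tensor_assoc_bilinear[OF mods']
  let ?P = "tensor L (tensor M N)" and ?P' = "tensor L' (tensor M' N')"
  let ?gh = "tensor_map M' N' g h" and ?fg = "tensor_map L' M' f g"
  let ?fgh = "tensor_map L' (tensor M' N') f ?gh"
  note P' = module_tensor3[OF mods']
  have gh: "?gh \<in> linear_maps (tensor M N) (tensor M' N')"
    by (rule tensor_map_linear[OF mods(2,3) mods'(2,3) fgh(2,3)])
  have lfg: "?fg \<in> linear_maps (tensor L M) (tensor L' M')"
    by (rule tensor_map_linear[OF mods(1,2) mods'(1,2) fgh(1,2)])
  have lfgh: "?fgh \<in> linear_maps ?P ?P'"
    by (rule tensor_map_linear[OF mods(1) module_tensor[OF mods(2,3)] mods'(1)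
          module_tensor[OF mods'(2,3)] fgh(1) gh])
  have "tensor_assoc L' M' N' (tensor_map (tensor L' M') N' ?fg h T)
      = tensor_lift ?P' (\<lambda>t w. tensor_lift ?P'
          (\<lambda>u v. pure_tensor L' (tensor M' N') u (pure_tensor M' N' v (h w))) (?fg t)) T"
    unfolding tensor_assoc_def
    by (rule tensor_lift_map[OF module_tensor[OF mods(1,2)] mods(3) module_tensor[OF mods'(1,2)]
          mods'(3) lfg fgh(3) P' ab(2) T])
  also have "\<dots> = tensor_lift ?P' (\<lambda>t w. ?fgh (tensor_lift ?P
      (\<lambda>u v. pure_tensor L (tensor M N) u (pure_tensor M N v w)) t)) T"
  \<comment> \<open>With \<open>t\<close> and \<open>w\<close> fixed, the inner lifts are compared
    by the same absorb-and-pull-out argument.\<close>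
  proof (rule tensor_lift_cong[OF module_tensor[OF mods(1,2)] mods(3) P' T
        bilinear_maps_comp[OF lfg fgh(3) ab(2)]])
    fix t w assume t: "t \<in> carrier (tensor L M)" and w: "w \<in> carrier N"
    have hw: "h w \<in> carrier N'" by (rule linear_maps_closed[OF fgh(3) w])
    have "tensor_lift ?P' (\<lambda>u v. pure_tensor L' (tensor M' N') u (pure_tensor M' N' v (h w))) (?fg t)
      = tensor_lift ?P' (\<lambda>u v. pure_tensor L' (tensor M' N') (f u) (pure_tensor M' N' (g v) (h w))) t"
      by (rule tensor_lift_map[OF mods(1,2) mods'(1,2) fgh(1,2) P' ab(1)[OF hw] t])
    also have "\<dots> = tensor_lift ?P'
        (\<lambda>u v. ?fgh (pure_tensor L (tensor M N) u (pure_tensor M N v w))) t"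
      by (rule tensor_lift_cong[OF mods(1,2) P' t bilinear_maps_comp[OF fgh(1,2) ab(1)[OF hw]]])
         (simp add: w tensor_map_pure[OF mods(1) module_tensor[OF mods(2,3)] mods'(1)
            module_tensor[OF mods'(2,3)] fgh(1) gh]
           tensor_map_pure[OF mods(2,3) mods'(2,3) fgh(2,3)] pure_tensor_closed[OF mods(2,3)])
    also have "\<dots> = ?fgh (tensor_lift ?P
        (\<lambda>u v. pure_tensor L (tensor M N) u (pure_tensor M N v w)) t)"
      by (rule tensor_lift_comp[symmetric,
            OF mods(1,2) module_tensor3[OF mods] P' tensor_assoc_inner_bilinear[OF mods w] lfgh t])
    finally show "tensor_lift ?P'
        (\<lambda>u v. pure_tensor L' (tensor M' N') u (pure_tensor M' N' v (h w))) (?fg t)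
      = ?fgh (tensor_lift ?P (\<lambda>u v. pure_tensor L (tensor M N) u (pure_tensor M N v w)) t)" .
  qed
  also have "\<dots> = ?fgh (tensor_assoc L M N T)"
    unfolding tensor_assoc_def
    by (rule tensor_lift_comp[symmetric,
          OF module_tensor[OF mods(1,2)] mods(3) module_tensor3[OF mods] P' tensor_assoc_bilinear[OF mods] lfgh T])
  finally show ?thesis .
qed

subsection \<open>Tensor products of algebras\<close>

lemma complex_algebra_module: "complex_algebra A \<Longrightarrow> module complex_alg A"
  by (rule complex_algebra.axioms(1))

lemma complex_algebra_mult_bilinear:
  assumes "complex_algebra A"
  shows "(\<lambda>u v. u \<otimes>\<^bsub>A\<^esub> v) \<in> bilinear_maps A A A"
proof -
  interpret complex_algebra A by fact
  show ?thesis
    by (auto intro!: bilinear_mapsI linear_mapsI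
        simp: smult_mult_left smult_mult_right l_distr r_distr)
qed

text \<open>The product in \<open>tensor\<close> is the class of a double sum of functions, whereas
  a lift is a sum of classes; additivity of the class map bridges the two.\<close>

lemma tensor_class_sum:
  assumes MN: "module complex_alg M" "module complex_alg N"
    and "finite K" "\<And>p. p \<in> K \<Longrightarrow> Poly_Mapping.keys (F p) \<subseteq> carrier M \<times> carrier N"
  shows "tensor_class M N (\<Sum>p\<in>K. F p) = (\<Oplus>\<^bsub>tensor M N\<^esub>p\<in>K. tensor_class M N (F p))"
proof -
  interpret T: module complex_alg "tensor M N" by (rule module_tensor[OF MN])
  show ?thesis
    using assms(3,4)
  proof induction
    case empty
    then show ?case by (simp add: tensor_zero[OF MN])
  next
    case (insert p K)
    then show ?case
      by (subst T.finsum_insert) (auto simp: tensor_class_add[OF MN, symmetric] intro!: tensor_class_closed[OF MN])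
  qed
qed

lemma keys_sum_subset:
  assumes "finite K" "\<And>p. p \<in> K \<Longrightarrow> Poly_Mapping.keys (F p) \<subseteq> S"
  shows "Poly_Mapping.keys (\<Sum>p\<in>K. F p) \<subseteq> S"
  using keys_sum[of F K] assms(2) by blast

text \<open>Both sides expand over the same chosen representatives of \<open>T\<close> and
  \<open>U\<close>, so the equality only regroups a double sum. Its value is that the product
  becomes an iterated lift, to which the rules for lifts apply without reference to
  representatives.\<close>

lemma tensor_mult:
  assumes A: "complex_algebra A" and B: "complex_algebra B"
    and T: "T \<in> carrier (tensor A B)" and U: "U \<in> carrier (tensor A B)"
  shows "T \<otimes>\<^bsub>tensor A B\<^esub> U = tensor_lift (tensor A B) (\<lambda>a b. tensor_lift (tensor A B)
    (\<lambda>a' b'. pure_tensor A B (a \<otimes>\<^bsub>A\<^esub> a') (b \<otimes>\<^bsub>B\<^esub> b')) U) T"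
proof -
  interpret A: complex_algebra A by (fact A)
  interpret B: complex_algebra B by (fact B)
  note AB = complex_algebra_module[OF A] complex_algebra_module[OF B]
  interpret T: module complex_alg "tensor A B" by (rule module_tensor[OF AB])
  let ?t = "tensor_rep T" and ?u = "tensor_rep U"
  let ?pure = "\<lambda>p r. pure_tensor A B (fst p \<otimes>\<^bsub>A\<^esub> fst r) (snd p \<otimes>\<^bsub>B\<^esub> snd r)"
  let ?s = "\<lambda>p r. Poly_Mapping.single (fst p \<otimes>\<^bsub>A\<^esub> fst r, snd p \<otimes>\<^bsub>B\<^esub> snd r)
    (Poly_Mapping.lookup ?t p * Poly_Mapping.lookup ?u r)"
  have keys: "Poly_Mapping.keys ?t \<subseteq> carrier A \<times> carrier B" "Poly_Mapping.keys ?u \<subseteq> carrier A \<times> carrier B"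
    using T U by (metis tensor_carrierE[OF AB] tensor_rep_keys[OF AB])+
  have mem: "fst p \<in> carrier A" "snd p \<in> carrier B" "fst r \<in> carrier A" "snd r \<in> carrier B"
    if "p \<in> Poly_Mapping.keys ?t" "r \<in> Poly_Mapping.keys ?u" for p r
    using subsetD[OF keys(1) that(1)] subsetD[OF keys(2) that(2)] by (auto simp: mem_Times_iff)
  have s_keys: "Poly_Mapping.keys (?s p r) \<subseteq> carrier A \<times> carrier B"
    if "p \<in> Poly_Mapping.keys ?t" "r \<in> Poly_Mapping.keys ?u" for p r
    using mem[OF that] by auto
  have pure: "?pure p r \<in> carrier (tensor A B)"
    if "p \<in> Poly_Mapping.keys ?t" "r \<in> Poly_Mapping.keys ?u" for p r
    using mem[OF that] by (intro pure_tensor_closed[OF AB]) auto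
  have "T \<otimes>\<^bsub>tensor A B\<^esub> U = tensor_class A B (\<Sum>p\<in>Poly_Mapping.keys ?t. \<Sum>r\<in>Poly_Mapping.keys ?u. ?s p r)"
    by (simp add: tensor_def)
  also have "\<dots> = (\<Oplus>\<^bsub>tensor A B\<^esub>p\<in>Poly_Mapping.keys ?t.
      tensor_class A B (\<Sum>r\<in>Poly_Mapping.keys ?u. ?s p r))"
    by (rule tensor_class_sum[OF AB finite_keys keys_sum_subset[OF finite_keys s_keys]])
  also have "\<dots> = (\<Oplus>\<^bsub>tensor A B\<^esub>p\<in>Poly_Mapping.keys ?t. Poly_Mapping.lookup ?t p \<odot>\<^bsub>tensor A B\<^esub>
      (\<Oplus>\<^bsub>tensor A B\<^esub>r\<in>Poly_Mapping.keys ?u. Poly_Mapping.lookup ?u r \<odot>\<^bsub>tensor A B\<^esub> ?pure p r))"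
  \<comment> \<open>The coefficient is a product; the factor depending on \<open>p\<close> alone
    leaves the inner sum.\<close>
  proof (rule T.finsum_cong'[OF refl])
    fix p assume p: "p \<in> Poly_Mapping.keys ?t"
    have "tensor_class A B (\<Sum>r\<in>Poly_Mapping.keys ?u. ?s p r)
        = (\<Oplus>\<^bsub>tensor A B\<^esub>r\<in>Poly_Mapping.keys ?u. tensor_class A B (?s p r))"
      by (rule tensor_class_sum[OF AB finite_keys s_keys[OF p]])
    also have "\<dots> = (\<Oplus>\<^bsub>tensor A B\<^esub>r\<in>Poly_Mapping.keys ?u.
        Poly_Mapping.lookup ?t p \<odot>\<^bsub>tensor A B\<^esub> (Poly_Mapping.lookup ?u r \<odot>\<^bsub>tensor A B\<^esub> ?pure p r))"
      by (rule T.finsum_cong'[OF refl])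
         (use pure[OF p] T.smult_assoc1 T.smult_closed in \<open>auto simp: tensor_class_single[OF AB]\<close>)
    also have "\<dots> = Poly_Mapping.lookup ?t p \<odot>\<^bsub>tensor A B\<^esub>
        (\<Oplus>\<^bsub>tensor A B\<^esub>r\<in>Poly_Mapping.keys ?u. Poly_Mapping.lookup ?u r \<odot>\<^bsub>tensor A B\<^esub> ?pure p r)"
      by (rule T.finsum_smult_ldistr[symmetric]) (use pure[OF p] T.smult_closed in auto)
    finally show "tensor_class A B (\<Sum>r\<in>Poly_Mapping.keys ?u. ?s p r) = Poly_Mapping.lookup ?t p \<odot>\<^bsub>tensor A B\<^esub>
        (\<Oplus>\<^bsub>tensor A B\<^esub>r\<in>Poly_Mapping.keys ?u. Poly_Mapping.lookup ?u r \<odot>\<^bsub>tensor A B\<^esub> ?pure p r)" .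
  qed (auto intro!: T.smult_closed T.finsum_closed pure)
  finally show ?thesis by (simp add: tensor_lift_def)
qed

context
  fixes A :: "(complex, 'a) module" and B :: "(complex, 'b) module"
  assumes alg: "complex_algebra A" "complex_algebra B"
begin

interpretation A: complex_algebra A by (fact alg(1))
interpretation B: complex_algebra B by (fact alg(2))

private lemmas mods = alg[THEN complex_algebra_module]

lemma tensor_left_mult_bilinear:
  assumes "a \<in> carrier A" "b \<in> carrier B"
  shows "(\<lambda>a' b'. pure_tensor A B (a \<otimes>\<^bsub>A\<^esub> a') (b \<otimes>\<^bsub>B\<^esub> b')) \<in> bilinear_maps A B (tensor A B)"
  by (rule bilinear_maps_comp[OF bilinear_mapsD(1)[OF complex_algebra_mult_bilinear[OF alg(1)] assms(1)]
        bilinear_mapsD(1)[OF complex_algebra_mult_bilinear[OF alg(2)] assms(2)]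
        pure_tensor_bilinear[OF mods]])

text \<open>The same expression read in the other pair of variables. It yields the linearity in
  \<open>a\<close> and in \<open>b\<close> when these become parameters of the inner lift of the
  product.\<close>

lemma tensor_right_mult_bilinear:
  assumes "a' \<in> carrier A" "b' \<in> carrier B"
  shows "(\<lambda>a b. pure_tensor A B (a \<otimes>\<^bsub>A\<^esub> a') (b \<otimes>\<^bsub>B\<^esub> b')) \<in> bilinear_maps A B (tensor A B)"
  by (rule bilinear_maps_comp[OF bilinear_mapsD(2)[OF complex_algebra_mult_bilinear[OF alg(1)] assms(1)]
        bilinear_mapsD(2)[OF complex_algebra_mult_bilinear[OF alg(2)] assms(2)]
        pure_tensor_bilinear[OF mods]])

lemma tensor_mult_bilinear:
  assumes U: "U \<in> carrier (tensor A B)"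
  shows "(\<lambda>a b. tensor_lift (tensor A B)
    (\<lambda>a' b'. pure_tensor A B (a \<otimes>\<^bsub>A\<^esub> a') (b \<otimes>\<^bsub>B\<^esub> b')) U) \<in> bilinear_maps A B (tensor A B)"
proof (rule bilinear_mapsI)
  fix a assume a: "a \<in> carrier A"
  show "(\<lambda>b. tensor_lift (tensor A B)
      (\<lambda>a' b'. pure_tensor A B (a \<otimes>\<^bsub>A\<^esub> a') (b \<otimes>\<^bsub>B\<^esub> b')) U) \<in> linear_maps B (tensor A B)"
    by (rule tensor_lift_param_linear[OF mods module_tensor[OF mods]
          tensor_left_mult_bilinear[OF a] bilinear_mapsD(1)[OF tensor_right_mult_bilinear a] mods(2) U])
next
  fix b assume b: "b \<in> carrier B"
  show "(\<lambda>a. tensor_lift (tensor A B)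
      (\<lambda>a' b'. pure_tensor A B (a \<otimes>\<^bsub>A\<^esub> a') (b \<otimes>\<^bsub>B\<^esub> b')) U) \<in> linear_maps A (tensor A B)"
    by (rule tensor_lift_param_linear[OF mods module_tensor[OF mods]
          tensor_left_mult_bilinear[OF _ b] bilinear_mapsD(2)[OF tensor_right_mult_bilinear b] mods(1) U])
qed

end

text \<open>With the product as a nested lift, multiplicativity comes down to
  \<open>f (a a') \<otimes> g (b b') = f a f a' \<otimes> g b g b'\<close> on pure tensors.\<close>

lemma tensor_map_algebra_hom:
  assumes alg: "complex_algebra A" "complex_algebra B" "complex_algebra A'" "complex_algebra B'"
    and f: "f \<in> algebra_homs A A'" and g: "g \<in> algebra_homs B B'"
  shows "tensor_map A' B' f g \<in> algebra_homs (tensor A B) (tensor A' B')"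
proof -
  interpret A: complex_algebra A by fact
  interpret B: complex_algebra B by fact
  note m = alg[THEN complex_algebra_module]
  have fl: "f \<in> linear_maps A A'" and gl: "g \<in> linear_maps B B'"
    and fr: "f \<in> ring_hom A A'" and gr: "g \<in> ring_hom B B'"
    using f g by (auto simp: algebra_homs_def)
  let ?P = "tensor A B" and ?P' = "tensor A' B'" and ?F = "tensor_map A' B' f g"
  note P = module_tensor[OF m(1,2)] and P' = module_tensor[OF m(3,4)]
  have Fl: "?F \<in> linear_maps ?P ?P'"
    by (rule tensor_map_linear[OF m fl gl])
  have mult: "?F (T \<otimes>\<^bsub>?P\<^esub> U) = ?F T \<otimes>\<^bsub>?P'\<^esub> ?F U"
    if T: "T \<in> carrier ?P" and U: "U \<in> carrier ?P" for T U
  proof -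
    have FT: "?F T \<in> carrier ?P'" and FU: "?F U \<in> carrier ?P'"
      using linear_maps_closed[OF Fl] T U by auto
    have "?F (T \<otimes>\<^bsub>?P\<^esub> U) = tensor_lift ?P' (\<lambda>a b. ?F (tensor_lift ?P
        (\<lambda>a' b'. pure_tensor A B (a \<otimes>\<^bsub>A\<^esub> a') (b \<otimes>\<^bsub>B\<^esub> b')) U)) T"
      unfolding tensor_mult[OF alg(1,2) T U]
      by (rule tensor_lift_comp[OF m(1,2) P P' tensor_mult_bilinear[OF alg(1,2) U] Fl T])
    also have "\<dots> = tensor_lift ?P' (\<lambda>a b. tensor_lift ?P'
        (\<lambda>a' b'. pure_tensor A' B' (f a \<otimes>\<^bsub>A'\<^esub> a') (g b \<otimes>\<^bsub>B'\<^esub> b')) (?F U)) T"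
    \<comment> \<open>For a fixed left factor \<open>a \<otimes> b\<close>, the inner lift over
      \<open>U\<close> becomes one over its image: apply the map under the lift, use that
      \<open>f\<close> and \<open>g\<close> are multiplicative, and absorb them into the
      argument.\<close>
    proof (rule tensor_lift_cong[OF m(1,2) P' T
          linear_bilinear_comp[OF tensor_mult_bilinear[OF alg(1,2) U] Fl]])
      fix a b assume ab: "a \<in> carrier A" "b \<in> carrier B"
      have fab: "f a \<in> carrier A'" "g b \<in> carrier B'"
        using ab linear_maps_closed[OF fl] linear_maps_closed[OF gl] by auto
      note inn = tensor_left_mult_bilinear[OF alg(1,2) ab] and inn' = tensor_left_mult_bilinear[OF alg(3,4) fab]
      have "?F (tensor_lift ?P (\<lambda>a' b'. pure_tensor A B (a \<otimes>\<^bsub>A\<^esub> a') (b \<otimes>\<^bsub>B\<^esub> b')) U)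
        = tensor_lift ?P' (\<lambda>a' b'. ?F (pure_tensor A B (a \<otimes>\<^bsub>A\<^esub> a') (b \<otimes>\<^bsub>B\<^esub> b'))) U"
        by (rule tensor_lift_comp[OF m(1,2) P P' inn Fl U])
      also have "\<dots> = tensor_lift ?P'
          (\<lambda>a' b'. pure_tensor A' B' (f a \<otimes>\<^bsub>A'\<^esub> f a') (g b \<otimes>\<^bsub>B'\<^esub> g b')) U"
        by (rule tensor_lift_cong[OF m(1,2) P' U linear_bilinear_comp[OF inn Fl]])
           (simp add: ab tensor_map_pure[OF m fl gl] ring_hom_mult[OF fr] ring_hom_mult[OF gr])
      also have "\<dots> = tensor_lift ?P'
          (\<lambda>a' b'. pure_tensor A' B' (f a \<otimes>\<^bsub>A'\<^esub> a') (g b \<otimes>\<^bsub>B'\<^esub> b')) (?F U)"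
        by (rule tensor_lift_map[symmetric, OF m fl gl P' inn' U])
      finally show "?F (tensor_lift ?P (\<lambda>a' b'. pure_tensor A B (a \<otimes>\<^bsub>A\<^esub> a') (b \<otimes>\<^bsub>B\<^esub> b')) U)
        = tensor_lift ?P' (\<lambda>a' b'. pure_tensor A' B' (f a \<otimes>\<^bsub>A'\<^esub> a') (g b \<otimes>\<^bsub>B'\<^esub> b')) (?F U)" .
    qed
    also have "\<dots> = ?F T \<otimes>\<^bsub>?P'\<^esub> ?F U"
      unfolding tensor_mult[OF alg(3,4) FT FU]
      by (rule tensor_lift_map[symmetric, OF m fl gl P' tensor_mult_bilinear[OF alg(3,4) FU] T])
    finally show ?thesis .
  qed
  \<comment> \<open>Stated for arbitrary factors because it is applied to source and target
    alike.\<close>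
  have one: "\<one>\<^bsub>tensor A B\<^esub> = pure_tensor A B \<one>\<^bsub>A\<^esub> \<one>\<^bsub>B\<^esub>"
    for A :: "(complex, 'x) module" and B :: "(complex, 'y) module"
    by (simp add: tensor_def pure_tensor_def)
  have "?F \<in> ring_hom ?P ?P'"
    by (rule ring_hom_memI)
       (simp_all add: mult linear_maps_closed[OF Fl] linear_maps_add[OF Fl] one
         tensor_map_pure[OF m fl gl] ring_hom_one[OF fr] ring_hom_one[OF gr])
  then show ?thesis using Fl by (simp add: algebra_homs_def)
qed

subsection \<open>Transport of Hopf algebras\<close>

text \<open>These are the bilinear maps behind the identifications of \<complex> \<otimes> C and C
  \<otimes> \<complex> with C in the counit axioms.\<close>

lemma smult_bilinear:
  assumes "module complex_alg C"
  shows "(\<lambda>c u. c \<odot>\<^bsub>C\<^esub> u) \<in> bilinear_maps complex_alg C C"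
    and "(\<lambda>u c. c \<odot>\<^bsub>C\<^esub> u) \<in> bilinear_maps C complex_alg C"
proof -
  interpret C: module complex_alg C by fact
  show "(\<lambda>c u. c \<odot>\<^bsub>C\<^esub> u) \<in> bilinear_maps complex_alg C C"
    "(\<lambda>u c. c \<odot>\<^bsub>C\<^esub> u) \<in> bilinear_maps C complex_alg C"
    using C.smult_closed C.smult_l_distr C.smult_r_distr C.smult_assoc1[symmetric]
    by (auto intro!: bilinear_mapsI linear_mapsI simp: mult.commute)
qed

lemma algebra_homs_comp:
  assumes "f \<in> algebra_homs A B" "g \<in> algebra_homs B C"
  shows "g \<circ> f \<in> algebra_homs A C"
  using assms ring_hom_trans[of f A B g C] linear_maps_comp[of f A B g C]
  by (auto simp: algebra_homs_def comp_def)

text \<open>The chosen preimage lies in \<open>carrier A\<close> and \<open>f\<close> is injective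
  there, so every identity for the inverse may be verified after applying \<open>f\<close>.\<close>

lemma inv_into_algebra_hom:
  assumes A: "complex_algebra A" and f: "f \<in> algebra_homs A B"
    and bij: "bij_betw f (carrier A) (carrier B)"
  shows "inv_into (carrier A) f \<in> algebra_homs B A"
proof -
  interpret A: complex_algebra A by fact
  let ?g = "inv_into (carrier A) f"
  have g: "?g y \<in> carrier A" "f (?g y) = y" if "y \<in> carrier B" for y
    using that bij by (auto simp: bij_betw_def inv_into_into f_inv_into_f)
  have eq: "?g y = x" if "x \<in> carrier A" "f x = y" for x y
    using that bij by (auto simp: bij_betw_def)
  have fr: "f \<in> ring_hom A B" and fl: "f \<in> linear_maps A B"
    using f by (auto simp: algebra_homs_def)
  have "?g \<in> ring_hom B A"
    by (rule ring_hom_memI)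
       (auto intro!: eq simp: g ring_hom_mult[OF fr] ring_hom_add[OF fr] ring_hom_one[OF fr])
  moreover have "?g \<in> linear_maps B A"
    by (rule linear_mapsI)
       (auto intro!: eq simp: g linear_maps_add[OF fl] linear_maps_smult[OF fl])
  ultimately show ?thesis by (simp add: algebra_homs_def)
qed

text \<open>Coassociativity calls for naturality of the associativity map. The two counit and two
  antipode axioms share one shape, a lift applied to a \<open>tensor_map\<close> of the coproduct,
  and are handled together by \<open>convolution\<close>.\<close>

lemma hopf_algebra_transport:
  assumes H: "hopf_algebra A \<Delta> counit S" and B: "complex_algebra B"
    and \<Psi>: "\<Psi> \<in> algebra_homs A B" and bij: "bij_betw \<Psi> (carrier A) (carrier B)"
  shows "hopf_algebra B (tensor_map B B \<Psi> \<Psi> \<circ> \<Delta> \<circ> inv_into (carrier A) \<Psi>)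
    (counit \<circ> inv_into (carrier A) \<Psi>) (\<Psi> \<circ> S \<circ> inv_into (carrier A) \<Psi>)"
proof -
  interpret H: hopf_algebra A \<Delta> counit S by fact
  interpret B: complex_algebra B by fact
  have A: "complex_algebra A" by unfold_locales
  note mA = complex_algebra_module[OF A] and mB = complex_algebra_module[OF B]
    and mC = module_complex_alg
  note mAA = module_tensor[OF mA mA] and mBB = module_tensor[OF mB mB]
  let ?\<Phi> = "inv_into (carrier A) \<Psi>" and ?\<Psi>2 = "tensor_map B B \<Psi> \<Psi>"
  let ?\<Delta> = "?\<Psi>2 \<circ> \<Delta> \<circ> ?\<Phi>" and ?e = "counit \<circ> ?\<Phi>" and ?S = "\<Psi> \<circ> S \<circ> ?\<Phi>"
  have \<Phi>: "?\<Phi> \<in> algebra_homs B A"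
    by (rule inv_into_algebra_hom[OF A \<Psi> bij])
  have \<Psi>2: "?\<Psi>2 \<in> algebra_homs (tensor A A) (tensor B B)"
    by (rule tensor_map_algebra_hom[OF A A B B \<Psi> \<Psi>])
  have \<Delta>_hom: "?\<Delta> \<in> algebra_homs B (tensor B B)"
    unfolding comp_assoc by (intro algebra_homs_comp[OF algebra_homs_comp[OF \<Phi> H.coproduct_hom] \<Psi>2, unfolded comp_assoc])
  have e_hom: "?e \<in> algebra_homs B complex_alg"
    by (rule algebra_homs_comp[OF \<Phi> H.counit_hom])
  have lin: "\<Psi> \<in> linear_maps A B" "?\<Phi> \<in> linear_maps B A" "?\<Psi>2 \<in> linear_maps (tensor A A) (tensor B B)"
    "\<Delta> \<in> linear_maps A (tensor A A)" "counit \<in> linear_maps A complex_alg"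
    "?\<Delta> \<in> linear_maps B (tensor B B)" "?e \<in> linear_maps B complex_alg"
    using \<Psi> \<Phi> \<Psi>2 H.coproduct_hom H.counit_hom \<Delta>_hom e_hom by (simp_all add: algebra_homs_def)
  note S = H.antipode_linear
  have S_lin: "?S \<in> linear_maps B B"
    using linear_maps_comp[OF linear_maps_comp[OF lin(2) S] lin(1)] by (simp add: comp_def)
  have \<Phi>\<Psi>: "?\<Phi> (\<Psi> x) = x" if "x \<in> carrier A" for x
    using that bij by (simp add: bij_betw_def)
  have \<Psi>\<Phi>: "\<Psi> (?\<Phi> h) = h" "?\<Phi> h \<in> carrier A" if "h \<in> carrier B" for h
    using that bij by (auto simp: bij_betw_def inv_into_into f_inv_into_f)
  have \<Delta>_cl: "\<Delta> x \<in> carrier (tensor A A)" if "x \<in> carrier A" for x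
    using linear_maps_closed[OF lin(4) that] .
  note comp = tensor_map_comp[OF mA mA] and cong = tensor_map_cong[OF mA mA]
  show ?thesis
  proof (intro hopf_algebra.intro hopf_algebra_axioms.intro B \<Delta>_hom e_hom S_lin)
    fix h assume h: "h \<in> carrier B"
    define x where "x = ?\<Phi> h"
    have x: "x \<in> carrier A" "\<Psi> x = h" using \<Psi>\<Phi>[OF h] by (auto simp: x_def)
    have \<Delta>h: "?\<Delta> h = ?\<Psi>2 (\<Delta> x)" and eh: "?e h = counit x" by (simp_all add: x_def)
    note D = \<Delta>_cl[OF x(1)]
    note idA = linear_maps_id[of A] and idB = linear_maps_id[of B]
    have "tensor_map (tensor B B) B ?\<Delta> (\<lambda>u. u) (?\<Delta> h)
        = tensor_map (tensor B B) B (\<lambda>u. ?\<Delta> (\<Psi> u)) \<Psi> (\<Delta> x)"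
      unfolding \<Delta>h by (rule comp[OF mB mB lin(1,1) mBB mB lin(6) idB D])
    \<comment> \<open>On \<open>carrier A\<close> the inverse cancels against \<Psi>, so the new
      coproduct after \<Psi> is the old one followed by \<Psi> \<otimes> \<Psi>.\<close>
    also have "\<dots> = tensor_map (tensor B B) B (\<lambda>u. ?\<Psi>2 (\<Delta> u)) \<Psi> (\<Delta> x)"
      by (rule cong[OF mBB mB linear_maps_comp[OF lin(1,6)] lin(1) D]) (simp_all add: \<Phi>\<Psi>)
    \<comment> \<open>Splitting off \<Delta> \<otimes> id exposes (\<Psi> \<otimes> \<Psi>)
      \<otimes> \<Psi>, the form that naturality of the associativity map expects.\<close>
    also have "\<dots> = tensor_map (tensor B B) B ?\<Psi>2 \<Psi> (tensor_map (tensor A A) A \<Delta> (\<lambda>u. u) (\<Delta> x))"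
      by (rule comp[symmetric, OF mAA mA lin(4) idA mBB mB lin(3,1) D])
    finally have "tensor_assoc B B B (tensor_map (tensor B B) B ?\<Delta> (\<lambda>u. u) (?\<Delta> h))
        = tensor_map B (tensor B B) \<Psi> ?\<Psi>2
            (tensor_assoc A A A (tensor_map (tensor A A) A \<Delta> (\<lambda>u. u) (\<Delta> x)))"
      using tensor_assoc_natural[OF mA mA mA mB mB mB lin(1,1,1)
          linear_maps_closed[OF tensor_map_linear[OF mA mA mAA mA lin(4) idA] D]] by simp
    also have "\<dots> = tensor_map B (tensor B B) \<Psi> ?\<Psi>2 (tensor_map A (tensor A A) (\<lambda>u. u) \<Delta> (\<Delta> x))"
      by (simp only: H.coassociative[OF x(1)])
    also have "\<dots> = tensor_map B (tensor B B) \<Psi> (\<lambda>u. ?\<Psi>2 (\<Delta> u)) (\<Delta> x)"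
      by (rule comp[OF mA mAA idA lin(4) mB mBB lin(1,3) D])
    also have "\<dots> = tensor_map B (tensor B B) \<Psi> (\<lambda>u. ?\<Delta> (\<Psi> u)) (\<Delta> x)"
      by (rule cong[OF mB mBB lin(1) linear_maps_comp[OF lin(4,3)] D]) (simp_all add: \<Phi>\<Psi>)
    also have "\<dots> = tensor_map B (tensor B B) (\<lambda>u. u) ?\<Delta> (?\<Delta> h)"
      unfolding \<Delta>h by (rule comp[symmetric, OF mB mB lin(1,1) mB mBB idB lin(6) D])
    finally show "tensor_assoc B B B (tensor_map (tensor B B) B ?\<Delta> (\<lambda>u. u) (?\<Delta> h))
        = tensor_map B (tensor B B) (\<lambda>u. u) ?\<Delta> (?\<Delta> h)" .
    \<comment> \<open>The intermediate factors are arbitrary so that one statement covers \<complex>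
      \<otimes> B, B \<otimes> \<complex> and B \<otimes> B. The last premise is the compatibility
      with \<Psi>, demanded only for arguments in \<open>carrier A\<close>.\<close>
    have convolution: "tensor_lift B \<beta>' (tensor_map P Q f' g' (?\<Delta> h))
        = \<Psi> (tensor_lift A \<beta> (tensor_map P0 Q0 f g (\<Delta> x)))"
      if "module complex_alg P" "module complex_alg Q" "module complex_alg P0" "module complex_alg Q0"
        "f \<in> linear_maps A P0" "g \<in> linear_maps A Q0" "f' \<in> linear_maps B P" "g' \<in> linear_maps B Q"
        "\<beta> \<in> bilinear_maps P0 Q0 A" "\<beta>' \<in> bilinear_maps P Q B"
        "\<And>u v. u \<in> carrier A \<Longrightarrow> v \<in> carrier A \<Longrightarrow> \<Psi> (\<beta> (f u) (g v)) = \<beta>' (f' (\<Psi> u)) (g' (\<Psi> v))"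
      for P :: "(complex, 'x) module" and Q :: "(complex, 'y) module"
        and P0 :: "(complex, 'z) module" and Q0 :: "(complex, 'w) module" and f g f' g' \<beta> \<beta>'
    proof -
      note bf = bilinear_maps_comp[OF that(7,8,10)] and b = bilinear_maps_comp[OF that(5,6,9)]
      have "tensor_lift B \<beta>' (tensor_map P Q f' g' (?\<Delta> h))
          = tensor_lift B (\<lambda>u v. \<beta>' (f' u) (g' v)) (?\<Psi>2 (\<Delta> x))"
        unfolding \<Delta>h
        by (rule tensor_lift_map[OF mB mB that(1,2,7,8) mB that(10) linear_maps_closed[OF lin(3) D]])
      also have "\<dots> = tensor_lift B (\<lambda>u v. \<beta>' (f' (\<Psi> u)) (g' (\<Psi> v))) (\<Delta> x)"
        by (rule tensor_lift_map[OF mA mA mB mB lin(1,1) mB bf D])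
      also have "\<dots> = tensor_lift B (\<lambda>u v. \<Psi> (\<beta> (f u) (g v))) (\<Delta> x)"
        by (rule tensor_lift_cong[OF mA mA mB D bilinear_maps_comp[OF lin(1,1) bf]])
           (simp add: that(11))
      also have "\<dots> = \<Psi> (tensor_lift A (\<lambda>u v. \<beta> (f u) (g v)) (\<Delta> x))"
        by (rule tensor_lift_comp[symmetric, OF mA mA mA mB b lin(1) D])
      also have "\<dots> = \<Psi> (tensor_lift A \<beta> (tensor_map P0 Q0 f g (\<Delta> x)))"
        by (simp only: tensor_lift_map[OF mA mA that(3-6) mA that(9) D])
      finally show ?thesis .
    qed
    show "tensor_lift B (\<lambda>c u. c \<odot>\<^bsub>B\<^esub> u) (tensor_map complex_alg B ?e (\<lambda>u. u) (?\<Delta> h)) = h"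
      \<comment> \<open>The compatibility premise reads
        \<open>\<Psi> (counit u \<odot> v) = counit u \<odot> \<Psi> v\<close>, because the
        transported counit at \<open>\<Psi> u\<close> is \<open>counit u\<close>.\<close>
      using convolution[OF mC mB mC mA lin(5) idA lin(7) idB smult_bilinear(1)[OF mA] smult_bilinear(1)[OF mB]]
      by (simp add: H.counit_left[OF x(1)] x \<Phi>\<Psi> linear_maps_smult[OF lin(1)])
    show "tensor_lift B (\<lambda>u c. c \<odot>\<^bsub>B\<^esub> u) (tensor_map B complex_alg (\<lambda>u. u) ?e (?\<Delta> h)) = h"
      using convolution[OF mB mC mA mC idA lin(5) idB lin(7) smult_bilinear(2)[OF mA] smult_bilinear(2)[OF mB]]
      by (simp add: H.counit_right[OF x(1)] x \<Phi>\<Psi> linear_maps_smult[OF lin(1)])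
    note mult_bil = complex_algebra_mult_bilinear[OF A] complex_algebra_mult_bilinear[OF B]
    have \<Psi>r: "\<Psi> \<in> ring_hom A B" using \<Psi> by (simp add: algebra_homs_def)
    \<comment> \<open>Read from right to left, this and the antipode axiom at \<open>x\<close> turn
      the right-hand side of each antipode goal into \<Psi> of a lift, which is the form of
      \<open>convolution\<close>.\<close>
    have unit: "\<Psi> (counit x \<odot>\<^bsub>A\<^esub> \<one>\<^bsub>A\<^esub>) = ?e h \<odot>\<^bsub>B\<^esub> \<one>\<^bsub>B\<^esub>"
      by (simp add: linear_maps_smult[OF lin(1)] ring_hom_one[OF \<Psi>r] eh[unfolded comp_def])
    show "tensor_lift B (\<lambda>u v. u \<otimes>\<^bsub>B\<^esub> v) (tensor_map B B ?S (\<lambda>u. u) (?\<Delta> h)) = ?e h \<odot>\<^bsub>B\<^esub> \<one>\<^bsub>B\<^esub>"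
      unfolding unit[symmetric] H.antipode_left[OF x(1), symmetric]
      by (rule convolution[OF mB mB mA mA S idA S_lin idB mult_bil])
         (simp add: \<Phi>\<Psi> ring_hom_mult[OF \<Psi>r] linear_maps_closed[OF S])
    show "tensor_lift B (\<lambda>u v. u \<otimes>\<^bsub>B\<^esub> v) (tensor_map B B (\<lambda>u. u) ?S (?\<Delta> h)) = ?e h \<odot>\<^bsub>B\<^esub> \<one>\<^bsub>B\<^esub>"
      unfolding unit[symmetric] H.antipode_right[OF x(1), symmetric]
      by (rule convolution[OF mB mB mA mA idA S idB S_lin mult_bil])
         (simp add: \<Phi>\<Psi> ring_hom_mult[OF \<Psi>r] linear_maps_closed[OF S])
  qed
qed

theorem theorem16:
  fixes A1 :: "(complex, 'a) module" and A2 :: "(complex, 'b) module"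
    and k1 k2 :: parameter_kind
    and n1 D1 n2 D2 :: nat
    and c1 c2 :: "nat \<Rightarrow> nat \<Rightarrow> free_alg fps"
    and b1 b2 :: "nat \<Rightarrow> free_alg fps"
    and q1 :: "free_alg fps \<Rightarrow> 'a" and q2 :: "free_alg fps \<Rightarrow> 'b"
    and \<Psi> :: "'a \<Rightarrow> 'b"
    and \<Delta>1 :: "'a \<Rightarrow> (('a \<times> 'a) \<Rightarrow>\<^sub>0 complex) set"
    and counit1 :: "'a \<Rightarrow> complex"
    and S1 :: "'a \<Rightarrow> 'a"
  assumes "ancg A1 k1 n1 D1 c1 b1 q1"
    and "ancg A2 k2 n2 D2 c2 b2 q2"
    and "ancg_iso A1 (q1 epsilon) A2 (q2 epsilon) \<Psi>"
    and "hopf_algebra A1 \<Delta>1 counit1 S1"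
  shows "hopf_algebra A2
    (tensor_map A2 A2 \<Psi> \<Psi> \<circ> \<Delta>1 \<circ> inv_into (carrier A1) \<Psi>)
    (counit1 \<circ> inv_into (carrier A1) \<Psi>)
    (\<Psi> \<circ> S1 \<circ> inv_into (carrier A1) \<Psi>)"
proof -
  have "complex_algebra A2" by (rule ancg.axioms(1)[OF assms(2)])
  with assms(3,4) show ?thesis
    by (auto simp: ancg_iso_def intro: hopf_algebra_transport)
qed

end
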